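(* Let $a,b$ be non-negative integers and let $p$ be a prime such that $p>2a+2b+3$. Then $$S_{p-1}(\{2\}^a,3,\{2\}^b)\equiv \frac{b-a}{(a+1)(b+1)}\binom{2a+2b+2}{2a+1} B_{p-2a-2b-3} \pmod{p},$$ $$H_{p-1}(\{2\}^a,3,\{2\}^b) \equiv \frac{(-1)^{a+b}(a-b)}{(a+1)(b+1)}\binom{2a+2b+2}{2a+1} B_{p-2a-2b-3} \pmod{p}.$$
   Context: For a sequence $(s_1,\dots,s_r)$ of positive integers and an integer $n\ge 0$: $H_n(s_1,\dots,s_r)=\sum_{1\le k_1<\cdots<k_r\le n}\frac{1}{k_1^{s_1}\cdots k_r^{s_r}}$ and $S_n(s_1,\dots,s_r)=\sum_{1\le k_1\le\cdots\le k_r\le n}\frac{1}{k_1^{s_1}\cdots k_r^{s_r}}$, with $H_n=0$ if $n<r$. $\{2\}^a$ denotes $2$ repeated $a$ times. $B_k$ are the Bernoulli numbers defined by $\frac{x}{e^x-1}=\sum_{k\ge0}B_k\frac{x^k}{k!}$. For rational numbers $x,y$, $x\equiv y\pmod{p^k}$ means that $x-y$ has $p$-adic valuation at least $k$. *)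

theory Defs
  imports "HOL-Computational_Algebra.Computational_Algebra"
begin

text \<open>
  The sum ranges over the index lists \<open>[k\<^sub>1, \<dots>, k\<^sub>r]\<close> with
  \<open>1 \<le> k\<^sub>1 < \<dots> < k\<^sub>r \<le> n\<close>, where \<open>r\<close> is the length of \<open>s\<close>. This set is finite, and it
  is empty if \<open>n < r\<close>. List positions start at 0, so \<open>ks ! i\<close> is \<open>k\<^sub>i\<^sub>+\<^sub>1\<close>.
\<close>

definition mhs_H :: "nat \<Rightarrow> nat list \<Rightarrow> rat" where
  "mhs_H n s =
     (\<Sum>ks | length ks = length s \<and> set ks \<subseteq> {1..n} \<and> sorted_wrt (<) ks.
        1 / (\<Prod>i<length s. of_nat (ks ! i) ^ (s ! i)))"

definition mhs_S :: "nat \<Rightarrow> nat list \<Rightarrow> rat" where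
  "mhs_S n s =
     (\<Sum>ks | length ks = length s \<and> set ks \<subseteq> {1..n} \<and> sorted_wrt (\<le>) ks.
        1 / (\<Prod>i<length s. of_nat (ks ! i) ^ (s ! i)))"

text \<open>
  Division of formal power series cancels the common factor \<open>X\<close> first, so the quotient below is
  the power series \<open>x / (e\<^sup>x - 1)\<close>; see \<open>bernoulli_fps\<close>. In particular \<open>B\<^sub>1 = -1/2\<close>.
\<close>

definition bernoulli :: "nat \<Rightarrow> rat" where
  "bernoulli k = fact k * fps_nth (fps_X / (fps_exp 1 - 1)) k"

lemma bernoulli_fps:
  "Abs_fps (\<lambda>k. bernoulli k / fact k) * (fps_exp 1 - 1) = fps_X"
proof -
  have nth1: "fps_nth (fps_exp 1 - 1 :: rat fps) 1 \<noteq> 0"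
    by simp
  then have nz: "(fps_exp 1 - 1 :: rat fps) \<noteq> 0"
    by (metis fps_zero_nth)
  have "subdegree (fps_exp 1 - 1 :: rat fps) = 1"
    using nth1 by (intro subdegreeI) auto
  then have "(fps_exp 1 - 1 :: rat fps) dvd fps_X"
    using nz by (simp add: fps_dvd_iff)
  moreover have "Abs_fps (\<lambda>k. bernoulli k / fact k) = fps_X / (fps_exp 1 - 1)"
    by (rule fps_ext) (simp add: bernoulli_def)
  ultimately show ?thesis
    by simp
qed

text \<open>
  The \<open>p\<close>-adic valuation of a non-zero rational number, from its reduced fraction. The valuation
  of 0 is infinity; \<open>rat_cong\<close> treats this case separately, and the value of \<open>padic_val p 0\<close>
  is irrelevant.
\<close>

definition padic_val :: "nat \<Rightarrow> rat \<Rightarrow> int" where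
  "padic_val p x =
     int (multiplicity (int p) (fst (quotient_of x))) -
     int (multiplicity (int p) (snd (quotient_of x)))"

definition rat_cong :: "nat \<Rightarrow> nat \<Rightarrow> rat \<Rightarrow> rat \<Rightarrow> bool" where
  "rat_cong p k x y \<longleftrightarrow> x = y \<or> padic_val p (x - y) \<ge> int k"

end

theory Submission
  imports Defs "HOL-Number_Theory.Residues"
begin

text \<open>
  Write \<open>p = 2 h + 1\<close> and \<open>S\<^sub>n(a, b)\<close>, \<open>H\<^sub>n(a, b)\<close> for the star and strict sums with exponents
  \<open>{2}\<^sup>a, 3, {2}\<^sup>b\<close> and indices up to \<open>n\<close>. The idea is to work with \<open>n = h\<close>, where everything is explicit
  modulo \<open>p\<close>, and to recover the sums up to \<open>p - 1\<close> from the reflection \<open>k \<mapsto> p - k\<close>.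

  The partial fraction decomposition of \<open>\<Prod>j = 1..n. 1 / (1 - X / j\<^sup>2)\<close> expresses the star sum over \<open>{2}\<^sup>a\<close>
  as \<open>\<Sum>j = 1..n. K\<^sub>n(j) / j\<^sup>2\<^sup>a\<close> with a kernel \<open>K\<^sub>n\<close> that is a quotient of factorials. The same kernel
  works for \<open>S\<^sub>n(a, b)\<close> (\<open>star_sum_2s_3_2s\<close>):
  \<open>K\<^sub>n(j)\<close> is then summed against \<open>j\<^sup>-\<^sup>2\<^sup>b\<^sup>-\<^sup>2 (j\<^sup>-\<^sup>2\<^sup>a\<^sup>-\<^sup>1 + 2 (\<Sum>m<j. m\<^sup>-\<^sup>2\<^sup>a\<^sup>-\<^sup>1))\<close>.
  For \<open>n = h\<close> the kernel is constantly \<open>-2\<close> modulo \<open>p\<close>. Hence the sums over \<open>{2}\<^sup>a\<close> vanish for \<open>0 < a < h\<close>,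
  and \<open>S\<^sub>h(a, b)\<close> becomes a double sum, which reflection turns into
  \<open>2 (\<Sum>m<j<p. m\<^sup>-\<^sup>2\<^sup>b\<^sup>-\<^sup>2 j\<^sup>-\<^sup>2\<^sup>a\<^sup>-\<^sup>1)\<close>. Fermat's theorem and Faulhaber's formula evaluate it, and
  \<open>(b + 1) S\<^sub>h(a, b) \<equiv> - C B\<close> with \<open>C\<close> the binomial coefficient and \<open>B\<close> the Bernoulli number of the
  theorem (\<open>half_star_sum_2s_3_2s_cong\<close>).

  Since the sums over \<open>{2}\<^sup>c\<close> and half of the range vanish for \<open>0 < c < h\<close>, splitting the chains at \<open>h\<close> gives
  \<open>S\<^sub>p\<^sub>-\<^sub>1(a, b) \<equiv> S\<^sub>h(a, b) - S\<^sub>h(b, a)\<close> (\<open>star_sum_2s_3_2s_split_half\<close>). As \<open>C\<close> and \<open>B\<close> are symmetric in \<open>a\<close>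
  and \<open>b\<close>, this is \<open>C B (1 / (a + 1) - 1 / (b + 1))\<close>, the first congruence. For the second one,
  \<open>\<Prod>j = 1..p - 1. 1 - X / j\<^sup>2\<close> is 1 modulo \<open>p\<close> and \<open>X\<^sup>h\<close>, so elementary symmetric functions of some of the
  \<open>1 / j\<^sup>2\<close> are, up to sign, complete homogeneous ones of the others. This yields
  \<open>H\<^sub>p\<^sub>-\<^sub>1(a, b) \<equiv> (-1)\<^sup>a\<^sup>+\<^sup>b S\<^sub>p\<^sub>-\<^sub>1(b, a)\<close> (\<open>strict_sum_2s_3_2s_cong_star_sum\<close>).
\<close>

section \<open>Nested harmonic sums\<close>

text \<open>
  The chains \<open>k\<^sub>1, k\<^sub>2, \<dots>\<close> are summed from the first entry on: after \<open>k\<close> the next entry is at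
  least \<open>g k\<close>. The identity gives weakly increasing chains and \<open>Suc\<close> strictly increasing ones, so
  that both kinds of harmonic sums are handled by the same induction.
\<close>

fun nested_sum :: "(nat \<Rightarrow> nat) \<Rightarrow> nat \<Rightarrow> nat \<Rightarrow> nat list \<Rightarrow> rat" where
  "nested_sum g l n [] = 1"
| "nested_sum g l n (s # ss) =
     (\<Sum>k = l..n. inverse (of_nat k) ^ s * nested_sum g (g k) n ss)"

abbreviation star_sum :: "nat \<Rightarrow> nat \<Rightarrow> nat list \<Rightarrow> rat" where
  "star_sum \<equiv> nested_sum (\<lambda>k. k)"

abbreviation strict_sum :: "nat \<Rightarrow> nat \<Rightarrow> nat list \<Rightarrow> rat" where
  "strict_sum \<equiv> nested_sum Suc"

lemma sum_over_chains_eq_nested_sum: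
  assumes r: "\<And>k j. r k j \<longleftrightarrow> g k \<le> j" and g: "\<And>k. k \<le> g k"
  shows "(\<Sum>ks | length ks = length s \<and> set ks \<subseteq> {l..n} \<and> sorted_wrt r ks.
           1 / (\<Prod>i<length s. of_nat (ks ! i) ^ (s ! i))) = nested_sum g l n s"
proof (induction s arbitrary: l)
  case Nil
  have "{ks. ks = [] \<and> set ks \<subseteq> {l..n} \<and> sorted_wrt r ks} = {[]}"
    by auto
  then show ?case by simp
next
  case (Cons x s)
  define C where "C = (\<lambda>l. {ks. length ks = length s \<and> set ks \<subseteq> {l..n} \<and> sorted_wrt r ks})"
  have IH: "(\<Sum>ks\<in>C l. 1 / (\<Prod>i<length s. of_nat (ks ! i) ^ (s ! i))) = nested_sum g l n s" for l
    unfolding C_def by (rule Cons.IH)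
  have fin: "finite (C l)" for l
    unfolding C_def by (rule finite_subset[OF _ finite_lists_length_eq[of "{l..n}" "length s"]]) auto
  have set_eq: "{ks. length ks = length (x # s) \<and> set ks \<subseteq> {l..n} \<and> sorted_wrt r ks} =
      (\<lambda>(k, ks). k # ks) ` (SIGMA k:{l..n}. C (g k))" (is "?L = ?R")
  proof (intro equalityI subsetI)
    fix ks assume "ks \<in> ?L"
    then obtain k ks' where "ks = k # ks'" "k \<in> {l..n}" "ks' \<in> C (g k)"
      by (cases ks) (auto simp: C_def r subset_iff)
    then show "ks \<in> ?R" by force
  next
    fix ks assume "ks \<in> ?R"
    then obtain k ks' where ks: "ks = k # ks'" and k: "k \<in> {l..n}" and "ks' \<in> C (g k)"
      by auto
    then show "ks \<in> ?L"
      using order.trans[OF g[of k]] by (force simp: C_def r)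
  qed
  have inj: "inj_on (\<lambda>(k, ks). k # ks) (SIGMA k:{l..n}. C (g k))"
    by (auto simp: inj_on_def)
  have "(\<Sum>ks | length ks = length (x # s) \<and> set ks \<subseteq> {l..n} \<and> sorted_wrt r ks.
           1 / (\<Prod>i<length (x # s). of_nat (ks ! i) ^ ((x # s) ! i)) :: rat) =
        (\<Sum>(k, ks)\<in>(SIGMA k:{l..n}. C (g k)).
           inverse (of_nat k) ^ x * (1 / (\<Prod>i<length s. of_nat (ks ! i) ^ (s ! i))))"
    unfolding set_eq sum.reindex[OF inj]
    by (intro sum.cong)
       (auto simp: prod.lessThan_Suc_shift field_simps simp del: prod.lessThan_Suc)
  also have "\<dots> = (\<Sum>k = l..n. \<Sum>ks\<in>C (g k).
           inverse (of_nat k) ^ x * (1 / (\<Prod>i<length s. of_nat (ks ! i) ^ (s ! i))))"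
    by (rule sum.Sigma[symmetric]) (auto simp: fin)
  also have "\<dots> = nested_sum g l n (x # s)"
    by (simp only: sum_distrib_left[symmetric] IH nested_sum.simps)
  finally show ?case .
qed

lemma mhs_S_eq_star_sum: "mhs_S n s = star_sum 1 n s"
  unfolding mhs_S_def by (rule sum_over_chains_eq_nested_sum) auto

lemma mhs_H_eq_strict_sum: "mhs_H n s = strict_sum 1 n s"
  unfolding mhs_H_def by (rule sum_over_chains_eq_nested_sum) auto

text \<open>
  A chain is cut at the entry \<open>k\<close> that belongs to the exponent \<open>s\<close>. The earlier entries are bounded
  by \<open>g' k\<close>, where \<open>g'\<close> is the adjoint of \<open>g\<close>; this lets the two outer summations trade places.
\<close>

lemma nested_sum_append:
  assumes adj: "\<And>j k. 1 \<le> k \<Longrightarrow> g j \<le> k \<longleftrightarrow> j \<le> g' k"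
    and g: "\<And>k. k \<le> g k" and l: "1 \<le> l"
  shows "nested_sum g l n (xs @ s # ys) =
    (\<Sum>k = l..n. nested_sum g l (g' k) xs * inverse (of_nat k) ^ s * nested_sum g (g k) n ys)"
  using l
proof (induction xs arbitrary: l)
  case Nil
  then show ?case by simp
next
  case (Cons x xs)
  define t where "t j k = inverse (of_nat j) ^ x *
    (nested_sum g (g j) (g' k) xs * inverse (of_nat k) ^ s * nested_sum g (g k) n ys)" for j k
  have g1: "1 \<le> g j" if "j \<ge> l" for j
    using g[of j] that Cons.prems by linarith
  have "nested_sum g l n ((x # xs) @ s # ys) = (\<Sum>j = l..n. \<Sum>k = g j..n. t j k)"
    using Cons.IH g1 by (simp add: t_def sum_distrib_left)
  also have "\<dots> = (\<Sum>k = l..n. \<Sum>j = l..g' k. t j k)"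
  proof -
    have "(SIGMA j:{l..n}. {g j..n}) = (\<lambda>(k, j). (j, k)) ` (SIGMA k:{l..n}. {l..g' k})"
    proof (intro equalityI subsetI)
      fix z assume "z \<in> (SIGMA j:{l..n}. {g j..n})"
      then obtain j k where z: "z = (j, k)" and j: "l \<le> j" "g j \<le> k" and k: "k \<le> n"
        by auto
      then have "l \<le> k" using g[of j] by linarith
      moreover from this have "j \<le> g' k" using adj[of k j] Cons.prems j by auto
      ultimately have "(k, j) \<in> (SIGMA k:{l..n}. {l..g' k})" using j k by auto
      then show "z \<in> (\<lambda>(k, j). (j, k)) ` (SIGMA k:{l..n}. {l..g' k})"
        using z by (intro rev_image_eqI) auto
    next
      fix z assume "z \<in> (\<lambda>(k, j). (j, k)) ` (SIGMA k:{l..n}. {l..g' k})"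
      then obtain j k where z: "z = (j, k)" and k: "l \<le> k" "k \<le> n" and j: "l \<le> j" "j \<le> g' k"
        by auto
      then have "g j \<le> k" using adj[of k j] Cons.prems by auto
      then show "z \<in> (SIGMA j:{l..n}. {g j..n})"
        using z k j g[of j] by auto
    qed
    moreover have "inj_on (\<lambda>(k, j). (j, k)) (SIGMA k:{l..n}. {l..g' k})"
      by (auto simp: inj_on_def)
    ultimately show ?thesis
      by (simp add: sum.Sigma sum.reindex case_prod_unfold)
  qed
  also have "\<dots> = (\<Sum>k = l..n. nested_sum g l (g' k) (x # xs) * inverse (of_nat k) ^ s *
      nested_sum g (g k) n ys)"
    by (simp add: t_def sum_distrib_right mult.assoc)
  finally show ?case .
qed

lemma star_sum_append:
  "star_sum 1 n (xs @ s # ys) =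
    (\<Sum>k = 1..n. star_sum 1 k xs * inverse (of_nat k) ^ s * star_sum k n ys)"
  by (rule nested_sum_append) auto

lemma strict_sum_append:
  "strict_sum 1 n (xs @ s # ys) =
    (\<Sum>k = 1..n. strict_sum 1 (k - 1) xs * inverse (of_nat k) ^ s * strict_sum (Suc k) n ys)"
  by (rule nested_sum_append) auto

section \<open>Generating functions for repeated twos\<close>

text \<open>
  The generating function of the complete homogeneous sums in one variable, that is \<open>1 / (1 - c X)\<close>.
\<close>

definition geometric_fps :: "'a::field \<Rightarrow> 'a fps" where
  "geometric_fps c = Abs_fps (\<lambda>i. c ^ i)"

lemma geometric_fps_inverse: "geometric_fps c * (1 - fps_const c * fps_X) = 1"
proof (rule fps_ext)
  fix n show "fps_nth (geometric_fps c * (1 - fps_const c * fps_X)) n = fps_nth 1 n"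
    by (cases n) (simp_all add: geometric_fps_def right_diff_distrib mult.commute[of "fps_const c"]
        mult.assoc[symmetric])
qed

text \<open>
  The sums over \<open>{2}\<^sup>a\<close> are the complete homogeneous symmetric functions of the numbers \<open>1 / j\<^sup>2\<close>.
  Removing the smallest index \<open>l\<close> divides the product by \<open>1 / (1 - X / l\<^sup>2)\<close>, which is the
  recursion of the star sums on the position of the first entry.
\<close>

lemma star_sum_fps:
  "Abs_fps (\<lambda>a. star_sum l n (replicate a 2)) =
    (\<Prod>j = l..n. geometric_fps (inverse (of_nat j) ^ 2))"
proof (induction "Suc n - l" arbitrary: l)
  case 0
  then have "star_sum l n (replicate a 2) = (if a = 0 then 1 else 0)" for a
    by (cases a) auto
  with 0 show ?case by (auto intro!: fps_ext)
next
  case (Suc d)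
  define c :: rat where "c = inverse (of_nat l) ^ 2"
  define F where "F l = Abs_fps (\<lambda>a. star_sum l n (replicate a 2))" for l
  have l: "l \<le> n" using Suc by auto
  have "F l * (1 - fps_const c * fps_X) = F (Suc l)"
  proof (rule fps_ext)
    fix a show "fps_nth (F l * (1 - fps_const c * fps_X)) a = fps_nth (F (Suc l)) a"
    proof (cases a)
      case (Suc a')
      then show ?thesis
        using l by (simp add: F_def c_def right_diff_distrib mult.commute[of "fps_const _"]
            mult.assoc[symmetric] sum.atLeast_Suc_atMost)
    qed (simp add: F_def)
  qed
  moreover have "F l = geometric_fps c * (F l * (1 - fps_const c * fps_X))"
    by (simp only: mult.left_commute[of "geometric_fps c"] geometric_fps_inverse mult_1_right)
  ultimately have "F l = geometric_fps c * F (Suc l)"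
    by simp
  also have "F (Suc l) = (\<Prod>j = Suc l..n. geometric_fps (inverse (of_nat j) ^ 2))"
    unfolding F_def using Suc by (intro Suc(1)) auto
  also have "geometric_fps c * \<dots> = (\<Prod>j = l..n. geometric_fps (inverse (of_nat j) ^ 2))"
    using l by (simp add: c_def prod.atLeast_Suc_atMost)
  finally show ?case by (simp add: F_def)
qed

text \<open>
  Similarly, the strict sums over \<open>{2}\<^sup>a\<close> are elementary symmetric functions of the \<open>1 / j\<^sup>2\<close>. The sign
  makes the product on the right the inverse of the one for star sums.
\<close>

lemma strict_sum_fps:
  "Abs_fps (\<lambda>a. (-1) ^ a * strict_sum l n (replicate a 2)) =
    (\<Prod>j = l..n. 1 - fps_const (inverse (of_nat j) ^ 2) * fps_X)"
proof (induction "Suc n - l" arbitrary: l)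
  case 0
  then have "strict_sum l n (replicate a 2) = (if a = 0 then 1 else 0)" for a
    by (cases a) auto
  with 0 show ?case by (auto intro!: fps_ext)
next
  case (Suc d)
  define c :: rat where "c = inverse (of_nat l) ^ 2"
  define F where "F l = Abs_fps (\<lambda>a. (-1) ^ a * strict_sum l n (replicate a 2))" for l
  have l: "l \<le> n" using Suc by auto
  have "F l = (1 - fps_const c * fps_X) * F (Suc l)"
  proof (rule fps_ext)
    fix a show "fps_nth (F l) a = fps_nth ((1 - fps_const c * fps_X) * F (Suc l)) a"
    proof (cases a)
      case (Suc a')
      then show ?thesis
        using l by (simp add: F_def c_def left_diff_distrib mult.assoc sum.atLeast_Suc_atMost algebra_simps)
    qed (simp add: F_def)
  qed
  also have "F (Suc l) = (\<Prod>j = Suc l..n. 1 - fps_const (inverse (of_nat j) ^ 2) * fps_X)"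
    unfolding F_def using Suc by (intro Suc(1)) auto
  also have "(1 - fps_const c * fps_X) * \<dots> =
      (\<Prod>j = l..n. 1 - fps_const (inverse (of_nat j) ^ 2) * fps_X)"
    using l by (simp add: c_def prod.atLeast_Suc_atMost)
  finally show ?case by (simp add: F_def)
qed

section \<open>Partial fractions of star sums\<close>

text \<open>
  This is \<open>2 (-1)\<^sup>m\<^sup>-\<^sup>1 n!\<^sup>2 / ((n - m)! (n + m)!)\<close> for \<open>m \<le> n\<close>, the coefficient of \<open>1 / (1 - X / m\<^sup>2)\<close> in the
  partial fraction decomposition of \<open>\<Prod>j = 1..n. 1 / (1 - X / j\<^sup>2)\<close>. The product form extends it to
  \<open>m = 0\<close> with the value \<open>-2\<close>, and each of its factors is congruent to 1 modulo \<open>p\<close> if \<open>n = (p - 1) / 2\<close>.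
\<close>

definition star_kernel :: "nat \<Rightarrow> nat \<Rightarrow> rat" where
  "star_kernel n m = -2 * (\<Prod>i<m. - ((of_nat n - of_nat i) / (of_nat n + of_nat i + 1)))"

lemma star_kernel_Suc:
  "star_kernel n (Suc m) = - star_kernel n m * (of_nat n - of_nat m) / (of_nat n + of_nat m + 1)"
  by (simp add: star_kernel_def)

text \<open>
  The tails telescope: \<open>u m = - K m (n - m) / (2 n)\<close> satisfies \<open>u (m - 1) - u m = K m\<close> and \<open>u n = 0\<close>,
  where \<open>K\<close> is the kernel.
\<close>

lemma star_kernel_tail:
  assumes "m \<le> n" "0 < n"
  shows "2 * (\<Sum>j = Suc m..n. star_kernel n j) =
    - star_kernel n m * (of_nat n - of_nat m) / of_nat n"
  using assms
proof (induction "n - m" arbitrary: m)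
  case 0
  then show ?case by simp
next
  case (Suc d)
  then have "2 * (\<Sum>j = Suc m..n. star_kernel n j) =
      2 * star_kernel n (Suc m) + 2 * (\<Sum>j = Suc (Suc m)..n. star_kernel n j)"
    by (simp add: sum.atLeast_Suc_atMost algebra_simps)
  also have "2 * (\<Sum>j = Suc (Suc m)..n. star_kernel n j) =
      - star_kernel n (Suc m) * (of_nat n - of_nat (Suc m)) / of_nat n"
    using Suc by (intro Suc(1)) auto
  also have "2 * star_kernel n (Suc m) + \<dots> =
      star_kernel n (Suc m) * (of_nat n + of_nat m + 1) / of_nat n"
    using Suc.prems by (simp add: field_simps)
  also have "\<dots> = - star_kernel n m * (of_nat n - of_nat m) / of_nat n"
  proof -
    have "of_nat n + of_nat m + 1 \<noteq> (0::rat)"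
      using of_nat_neq_0[of "n + m", where 'a = rat] by (simp add: algebra_simps)
    then show ?thesis by (simp add: star_kernel_Suc)
  qed
  finally show ?case .
qed

text \<open>
  Passing from \<open>n + 1\<close> to \<open>n\<close> multiplies the coefficient at \<open>j\<close> by \<open>1 - j\<^sup>2 / (n + 1)\<^sup>2\<close>, the value of the
  removed factor at the pole \<open>X = j\<^sup>2\<close>.
\<close>

lemma star_kernel_pred:
  "star_kernel n j * of_nat (Suc n) ^ 2 = star_kernel (Suc n) j * (of_nat (Suc n) ^ 2 - of_nat j ^ 2)"
proof (induction j)
  case 0
  then show ?case by (simp add: star_kernel_def)
next
  case (Suc j)
  define N J :: rat where "N = of_nat n" and "J = of_nat j"
  have nz: "N + J + 1 \<noteq> 0" "N + J + 2 \<noteq> 0"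
    using of_nat_neq_0[of "n + j", where 'a = rat] of_nat_neq_0[of "Suc (n + j)", where 'a = rat]
    by (simp_all add: N_def J_def algebra_simps)
  have IH: "star_kernel n j * (N + 1) ^ 2 = star_kernel (Suc n) j * ((N + 1) ^ 2 - J ^ 2)"
    using Suc.IH by (simp add: N_def J_def add.commute)
  have "star_kernel n (Suc j) * of_nat (Suc n) ^ 2 =
      - (star_kernel n j * (N + 1) ^ 2) * (N - J) / (N + J + 1)"
    by (simp add: star_kernel_Suc N_def J_def add.commute)
  also have "\<dots> = - (star_kernel (Suc n) j * ((N + 1) ^ 2 - J ^ 2)) * (N - J) / (N + J + 1)"
    by (simp only: IH)
  also have "(N + 1) ^ 2 - J ^ 2 = (N + J + 1) * (N + 1 - J)"
    by (simp add: power2_eq_square algebra_simps)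
  also have "- (star_kernel (Suc n) j * ((N + J + 1) * (N + 1 - J))) * (N - J) / (N + J + 1) =
      - star_kernel (Suc n) j * (N + 1 - J) * (N - J)"
    using nz by simp
  also have "\<dots> = - star_kernel (Suc n) j * (N + 1 - J) / (N + J + 2) * ((N + J + 2) * (N - J))"
    using nz by simp
  also have "(N + J + 2) * (N - J) = (N + 1) ^ 2 - (J + 1) ^ 2"
    by (simp add: power2_eq_square algebra_simps)
  also have "- star_kernel (Suc n) j * (N + 1 - J) / (N + J + 2) = star_kernel (Suc n) (Suc j)"
    by (simp add: star_kernel_Suc N_def J_def add_ac)
  finally show ?case by (simp add: N_def J_def add.commute)
qed

lemma star_kernel_eq_0: "n < j \<Longrightarrow> star_kernel n j = 0"
  by (auto simp: star_kernel_def)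

text \<open>
  The star sums of the theorem are transforms of explicit functions, built up from the constant 1:
  appending an exponent 2 to the sum divides the function by \<open>j\<^sup>2\<close>, and an additional factor \<open>1 / n\<close> acts
  by a partial summation.
\<close>

definition kernel_transform :: "nat \<Rightarrow> (nat \<Rightarrow> rat) \<Rightarrow> rat" where
  "kernel_transform n f = (\<Sum>j = 1..n. star_kernel n j * f j)"

text \<open>
  The tail formula at \<open>m = 0\<close>, where the kernel is \<open>-2\<close>.
\<close>

lemma kernel_transform_one: "0 < n \<Longrightarrow> kernel_transform n (\<lambda>_. 1) = 1"
  using star_kernel_tail[of 0 n] by (simp add: kernel_transform_def star_kernel_def)

text \<open>
  By \<open>star_kernel_pred\<close>, the right-hand side grows from \<open>n - 1\<close> to \<open>n\<close> by exactly the \<open>n\<close>-th summand of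
  the left-hand side.
\<close>

lemma sum_kernel_transform_div_square:
  "(\<Sum>k = 1..n. inverse (of_nat k) ^ 2 * kernel_transform k f) =
    kernel_transform n (\<lambda>j. inverse (of_nat j) ^ 2 * f j)"
proof (induction n)
  case 0
  then show ?case by (simp add: kernel_transform_def)
next
  case (Suc n)
  have step: "star_kernel n j * (inverse (of_nat j) ^ 2 * f j) +
      inverse (of_nat (Suc n)) ^ 2 * (star_kernel (Suc n) j * f j) =
      star_kernel (Suc n) j * (inverse (of_nat j) ^ 2 * f j)" if "j \<ge> 1" for j
  proof -
    define K J N where "K = star_kernel (Suc n) j" and "J = (of_nat j :: rat)"
      and "N = (of_nat (Suc n) :: rat)"
    have nz: "J \<noteq> 0" "N \<noteq> 0" using that by (auto simp: J_def N_def)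
    have "star_kernel n j = K * (N ^ 2 - J ^ 2) / N ^ 2"
      using star_kernel_pred[of n j] nz by (simp add: K_def J_def N_def field_simps del: of_nat_Suc)
    note * = this
    show ?thesis
      unfolding * K_def[symmetric] J_def[symmetric] N_def[symmetric]
      using nz by (simp add: field_simps)
  qed
  have "kernel_transform n (\<lambda>j. inverse (of_nat j) ^ 2 * f j) =
      (\<Sum>j = 1..Suc n. star_kernel n j * (inverse (of_nat j) ^ 2 * f j))"
    by (simp add: kernel_transform_def star_kernel_eq_0)
  moreover have "inverse (of_nat (Suc n)) ^ 2 * kernel_transform (Suc n) f =
      (\<Sum>j = 1..Suc n. inverse (of_nat (Suc n)) ^ 2 * (star_kernel (Suc n) j * f j))"
    unfolding kernel_transform_def by (rule sum_distrib_left)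
  ultimately have "(\<Sum>k = 1..Suc n. inverse (of_nat k) ^ 2 * kernel_transform k f) =
      (\<Sum>j = 1..Suc n. star_kernel n j * (inverse (of_nat j) ^ 2 * f j) +
        inverse (of_nat (Suc n)) ^ 2 * (star_kernel (Suc n) j * f j))"
    using Suc.IH by (simp add: sum.distrib del: of_nat_Suc)
  also have "\<dots> = kernel_transform (Suc n) (\<lambda>j. inverse (of_nat j) ^ 2 * f j)"
    unfolding kernel_transform_def by (intro sum.cong refl step) auto
  finally show ?case .
qed

text \<open>
  By \<open>star_kernel_tail\<close>, \<open>K m / n\<close> is \<open>1 / m\<close> times \<open>K m\<close> plus twice the tail after \<open>m\<close>, where \<open>K\<close> is the
  kernel for \<open>n\<close>. Exchanging the summations moves the tails into the argument of the transform.
\<close>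

lemma kernel_transform_div:
  assumes "0 < n"
  shows "inverse (of_nat n) * kernel_transform n f =
    kernel_transform n (\<lambda>j. inverse (of_nat j) * f j + 2 * (\<Sum>m = 1..<j. inverse (of_nat m) * f m))"
proof -
  define K where "K = star_kernel n"
  have swap: "(\<Sum>j = 1..n. K j * (\<Sum>m = 1..<j. inverse (of_nat m) * f m)) =
      (\<Sum>m = 1..n. \<Sum>j = Suc m..n. K j * (inverse (of_nat m) * f m))"
    unfolding sum_distrib_left by (subst sum.Sigma, simp, simp, subst sum.Sigma, simp, simp,
      rule sum.reindex_bij_witness[of _ "\<lambda>(m, j). (j, m)" "\<lambda>(j, m). (m, j)"]) auto
  have "kernel_transform n
        (\<lambda>j. inverse (of_nat j) * f j + 2 * (\<Sum>m = 1..<j. inverse (of_nat m) * f m)) =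
      (\<Sum>j = 1..n. K j * (inverse (of_nat j) * f j)) +
      2 * (\<Sum>j = 1..n. K j * (\<Sum>m = 1..<j. inverse (of_nat m) * f m))"
    by (simp add: kernel_transform_def K_def distrib_left sum.distrib
        sum_distrib_left mult.left_commute)
  also have "\<dots> = (\<Sum>m = 1..n. (K m + 2 * (\<Sum>j = Suc m..n. K j)) * (inverse (of_nat m) * f m))"
    unfolding swap
    by (simp add: distrib_right sum.distrib sum_distrib_left sum_distrib_right mult.assoc)
  also have "\<dots> = (\<Sum>m = 1..n. inverse (of_nat n) * (K m * f m))"
  proof (rule sum.cong[OF refl])
    fix m assume "m \<in> {1..n}"
    then have "K m + 2 * (\<Sum>j = Suc m..n. K j) = K m * of_nat m / of_nat n"
      using star_kernel_tail[of m n] assms by (simp add: K_def field_simps)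
    then show "(K m + 2 * (\<Sum>j = Suc m..n. K j)) * (inverse (of_nat m) * f m) =
        inverse (of_nat n) * (K m * f m)"
      using \<open>m \<in> {1..n}\<close> by (simp add: divide_inverse)
  qed
  also have "\<dots> = inverse (of_nat n) * kernel_transform n f"
    by (simp add: kernel_transform_def K_def sum_distrib_left)
  finally show ?thesis by simp
qed

lemma star_sum_2s:
  "0 < n \<Longrightarrow> star_sum 1 n (replicate a 2) = kernel_transform n (\<lambda>j. inverse (of_nat j) ^ (2 * a))"
proof (induction a arbitrary: n)
  case 0
  then show ?case by (simp add: kernel_transform_one)
next
  case (Suc a)
  have "star_sum 1 n (replicate (Suc a) 2) =
      (\<Sum>k = 1..n. inverse (of_nat k) ^ 2 * star_sum 1 k (replicate a 2))"
    using star_sum_append[of n "replicate a 2" 2 "[]"]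
    by (simp add: replicate_append_same mult.commute)
  also have "\<dots> = (\<Sum>k = 1..n. inverse (of_nat k) ^ 2 *
      kernel_transform k (\<lambda>j. inverse (of_nat j) ^ (2 * a)))"
    using Suc.IH by (intro sum.cong) auto
  also have "\<dots> = kernel_transform n (\<lambda>j. inverse (of_nat j) ^ (2 * Suc a))"
    unfolding sum_kernel_transform_div_square by (simp add: power2_eq_square mult.assoc)
  finally show ?case .
qed

text \<open>
  The exponent 3 contributes one factor \<open>1 / k\<close> more than an exponent 2, and this factor is the only
  source of the inner sum on the right.
\<close>

lemma star_sum_2s_3_2s:
  "star_sum 1 n (replicate a 2 @ 3 # replicate b 2) =
    kernel_transform n (\<lambda>j. inverse (of_nat j) ^ (2 * b + 2) *
      (inverse (of_nat j) ^ (2 * a + 1) + 2 * (\<Sum>m = 1..<j. inverse (of_nat m) ^ (2 * a + 1))))"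
proof (induction b arbitrary: n)
  case 0
  have "star_sum 1 n (replicate a 2 @ [3]) =
      (\<Sum>k = 1..n. inverse (of_nat k) ^ 2 * (inverse (of_nat k) *
        kernel_transform k (\<lambda>j. inverse (of_nat j) ^ (2 * a))))"
    unfolding star_sum_append by (intro sum.cong) (auto simp: star_sum_2s[unfolded One_nat_def] power3_eq_cube power2_eq_square)
  also have "\<dots> = (\<Sum>k = 1..n. inverse (of_nat k) ^ 2 *
      kernel_transform k (\<lambda>j. inverse (of_nat j) ^ (2 * a + 1) +
        2 * (\<Sum>m = 1..<j. inverse (of_nat m) ^ (2 * a + 1))))"
    by (intro sum.cong) (auto simp: kernel_transform_div)
  finally show ?case
    unfolding sum_kernel_transform_div_square by (simp add: power2_eq_square)
next
  case (Suc b)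
  have "star_sum 1 n (replicate a 2 @ 3 # replicate (Suc b) 2) =
      (\<Sum>k = 1..n. inverse (of_nat k) ^ 2 * star_sum 1 k (replicate a 2 @ 3 # replicate b 2))"
    using star_sum_append[of n "replicate a 2 @ 3 # replicate b 2" 2 "[]"]
    by (simp add: replicate_append_same mult.commute)
  then show ?case
    unfolding Suc.IH sum_kernel_transform_div_square by (simp add: power2_eq_square mult.assoc)
qed

section \<open>Power sums and double sums\<close>

text \<open>
  Faulhaber's formula. The generating function \<open>E\<close> of the power sums is geometric,
  \<open>E (e\<^sup>X - 1) = e\<^sup>n\<^sup>X - 1\<close>; multiplying with that of the Bernoulli numbers gives
  \<open>E X = B (e\<^sup>n\<^sup>X - 1)\<close>, whose coefficients at \<open>X\<^sup>N\<^sup>+\<^sup>1\<close> are compared.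
\<close>

lemma sum_of_powers_bernoulli:
  "of_nat (Suc N) * (\<Sum>m<n. of_nat m ^ N) =
    (\<Sum>i\<le>N. of_nat (Suc N choose i) * bernoulli i * of_nat n ^ (Suc N - i))"
proof -
  define B where "B = Abs_fps (\<lambda>k. bernoulli k / fact k)"
  define E where "E = (\<Sum>m<n. fps_exp (of_nat m :: rat))"
  have geo: "E * (fps_exp 1 - 1) = fps_exp (of_nat n) - 1"
    unfolding E_def by (induction n) (simp_all add: algebra_simps fps_exp_add_mult)
  have "B * (fps_exp (of_nat n) - 1) = E * (B * (fps_exp 1 - 1))"
    unfolding geo[symmetric] by (simp add: algebra_simps)
  then have "B * (fps_exp (of_nat n) - 1) = E * fps_X"
    unfolding B_def bernoulli_fps .
  then have "fps_nth (B * (fps_exp (of_nat n) - 1)) (Suc N) = fps_nth (E * fps_X) (Suc N)"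
    by simp
  also have "fps_nth (E * fps_X) (Suc N) = (\<Sum>m<n. of_nat m ^ N) / fact N"
    by (simp add: E_def fps_sum_nth sum_divide_distrib)
  also have "fps_nth (B * (fps_exp (of_nat n) - 1)) (Suc N) =
      (\<Sum>i\<le>N. bernoulli i / fact i * (of_nat n ^ (Suc N - i) / fact (Suc N - i)))"
    by (simp add: fps_mult_nth B_def atMost_atLeast0 mult.commute[of "fact _" "fact _"] del: fact_Suc)
  finally have "(\<Sum>m<n. of_nat m ^ N) * of_nat (Suc N) = fact (Suc N) *
      (\<Sum>i\<le>N. bernoulli i / fact i * (of_nat n ^ (Suc N - i) / fact (Suc N - i)))"
    by (simp add: field_simps)
  also have "\<dots> = (\<Sum>i\<le>N. of_nat (Suc N choose i) * bernoulli i * of_nat n ^ (Suc N - i))"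
    unfolding sum_distrib_left
    by (intro sum.cong) (simp_all add: binomial_fact del: fact_Suc binomial_Suc_Suc)
  finally show ?thesis by (simp add: mult.commute)
qed

text \<open>
  For \<open>n = 1\<close> the power sum is just \<open>0\<^sup>N\<close>.
\<close>

lemma bernoulli_recurrence:
  "of_nat (Suc N) * bernoulli N =
    of_nat (Suc N) * 0 ^ N - (\<Sum>i<N. of_nat (Suc N choose i) * bernoulli i)"
  using sum_of_powers_bernoulli[of N 1] by (simp add: lessThan_Suc_atMost[symmetric])

definition double_sum :: "nat \<Rightarrow> nat \<Rightarrow> nat \<Rightarrow> rat" where
  "double_sum n s t = (\<Sum>j = 1..n. inverse (of_nat j) ^ t * (\<Sum>m = 1..<j. inverse (of_nat m) ^ s))"

lemma sum_mult_sum_eq_double_sums: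
  "(\<Sum>j = 1..n. inverse (of_nat j) ^ s) * (\<Sum>j = 1..n. inverse (of_nat j) ^ t) =
    double_sum n s t + double_sum n t s + (\<Sum>j = 1..n. inverse (of_nat j) ^ (s + t))"
proof (induction n)
  case (Suc n)
  then show ?case
    by (simp add: double_sum_def atLeastLessThanSuc_atLeastAtMost algebra_simps power_add
        del: of_nat_Suc)
qed (simp add: double_sum_def)

section \<open>Congruences between rational numbers\<close>

text \<open>
  The parameter \<open>h\<close> names half of the range: the non-zero residues are the numbers \<open>1, \<dots>, h\<close> and their
  reflections \<open>p - 1, \<dots>, p - h\<close>.
\<close>

locale odd_prime_modulus =
  fixes p h :: nat
  assumes prime_p: "prime p" and p_eq: "p = 2 * h + 1"
begin

definition p_integers :: "rat set" where
  "p_integers = {of_int x / of_int y | x y. \<not> int p dvd y}"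

text \<open>
  Congruence in the ring of \<open>p\<close>-integral rationals. Both sides are required to be \<open>p\<close>-integral, so
  that the relation is compatible with products and powers without side conditions.
\<close>

definition cong_p :: "rat \<Rightarrow> rat \<Rightarrow> bool"  (infix "\<approx>" 50) where
  "x \<approx> y \<longleftrightarrow> x \<in> p_integers \<and> y \<in> p_integers \<and> (\<exists>z\<in>p_integers. x - y = of_nat p * z)"

lemma p_integersI: "\<not> int p dvd y \<Longrightarrow> x = of_int z / of_int y \<Longrightarrow> x \<in> p_integers"
  by (auto simp: p_integers_def)

lemma of_int_p_integer [simp]: "of_int x \<in> p_integers"
  using prime_p by (intro p_integersI[of 1 _ x]) (auto simp: prime_gt_Suc_0_nat zdvd1_eq)

lemma of_nat_p_integer [simp]: "of_nat n \<in> p_integers"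
  using of_int_p_integer[of "int n"] by simp

lemma zero_p_integer [simp]: "0 \<in> p_integers" and one_p_integer [simp]: "1 \<in> p_integers"
  using of_int_p_integer[of 0] of_int_p_integer[of 1] by simp_all

lemma numeral_p_integer [simp]: "numeral k \<in> p_integers"
  using of_int_p_integer[of "numeral k"] by simp

lemma p_integer_mult [simp]:
  assumes "x \<in> p_integers" "y \<in> p_integers" shows "x * y \<in> p_integers"
proof -
  obtain a b c d where "x = of_int a / of_int b" "y = of_int c / of_int d"
    "\<not> int p dvd b" "\<not> int p dvd d"
    using assms by (auto simp: p_integers_def)
  then show ?thesis
    using prime_p by (intro p_integersI[of "b * d" _ "a * c"]) (auto simp: prime_dvd_mult_iff)
qed

lemma p_integer_add [simp]:
  assumes "x \<in> p_integers" "y \<in> p_integers" shows "x + y \<in> p_integers"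
proof -
  obtain a b c d where *: "x = of_int a / of_int b" "y = of_int c / of_int d"
    "\<not> int p dvd b" "\<not> int p dvd d"
    using assms by (auto simp: p_integers_def)
  then have "b \<noteq> 0" "d \<noteq> 0" by auto
  with * show ?thesis
    using prime_p by (intro p_integersI[of "b * d" _ "a * d + c * b"])
      (auto simp: prime_dvd_mult_iff field_simps)
qed

lemma p_integer_minus [simp]: "x \<in> p_integers \<Longrightarrow> - x \<in> p_integers"
  using p_integer_mult[OF of_int_p_integer[of "-1"], of x] by simp

lemma p_integer_diff [simp]: "x \<in> p_integers \<Longrightarrow> y \<in> p_integers \<Longrightarrow> x - y \<in> p_integers"
  using p_integer_add[of x "- y"] by simp

lemma p_integer_power [simp]: "x \<in> p_integers \<Longrightarrow> x ^ n \<in> p_integers"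
  by (induction n) auto

lemma p_integer_sum: "(\<And>i. i \<in> A \<Longrightarrow> f i \<in> p_integers) \<Longrightarrow> sum f A \<in> p_integers"
  by (induction A rule: infinite_finite_induct) auto

lemma p_integer_inverse:
  assumes "0 < k" "k < p" shows "inverse (of_nat k) \<in> p_integers"
  using assms by (intro p_integersI[of "int k" _ 1]) (auto simp: divide_inverse dest: dvd_imp_le)

lemma cong_pI:
  "x \<in> p_integers \<Longrightarrow> y \<in> p_integers \<Longrightarrow> z \<in> p_integers \<Longrightarrow> x - y = of_nat p * z \<Longrightarrow> x \<approx> y"
  unfolding cong_p_def by blast

lemma cong_pE:
  assumes "x \<approx> y"
  obtains z where "x \<in> p_integers" "y \<in> p_integers" "z \<in> p_integers" "x = y + of_nat p * z"
  using assms unfolding cong_p_def by (auto simp: diff_eq_eq add.commute)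

lemma cong_p_refl [simp]: "x \<in> p_integers \<Longrightarrow> x \<approx> x"
  by (rule cong_pI[of _ _ 0]) auto

lemma cong_p_sym:
  assumes "x \<approx> y" shows "y \<approx> x"
  using assms
proof (rule cong_pE)
  fix z assume "x \<in> p_integers" "y \<in> p_integers" "z \<in> p_integers" "x = y + of_nat p * z"
  then show "y \<approx> x" by (intro cong_pI[of _ _ "- z"]) simp_all
qed

lemma cong_p_add:
  assumes "x \<approx> y" "x' \<approx> y'" shows "x + x' \<approx> y + y'"
proof -
  obtain z z' where "x \<in> p_integers" "y \<in> p_integers" "z \<in> p_integers" "x = y + of_nat p * z"
    "x' \<in> p_integers" "y' \<in> p_integers" "z' \<in> p_integers" "x' = y' + of_nat p * z'"
    using assms by (elim cong_pE) blast
  then show ?thesis by (intro cong_pI[of _ _ "z + z'"]) (simp_all add: algebra_simps)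
qed

lemma cong_p_mult:
  assumes "x \<approx> y" "x' \<approx> y'" shows "x * x' \<approx> y * y'"
proof -
  obtain z z' where z: "x \<in> p_integers" "y \<in> p_integers" "z \<in> p_integers" "x = y + of_nat p * z"
    "x' \<in> p_integers" "y' \<in> p_integers" "z' \<in> p_integers" "x' = y' + of_nat p * z'"
    using assms by (elim cong_pE) blast
  have "x * x' - y * y' = of_nat p * (x * z' + z * y')"
    unfolding z(4) z(8) by (simp add: algebra_simps)
  then show ?thesis using z(1-3,5-7) by (intro cong_pI[of _ _ "x * z' + z * y'"]) simp_all
qed

lemma cong_p_trans [trans]:
  assumes "x \<approx> y" "y \<approx> z" shows "x \<approx> z"
proof -
  obtain u u' where "x \<in> p_integers" "z \<in> p_integers" "u \<in> p_integers" "u' \<in> p_integers"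
    "x = y + of_nat p * u" "y = z + of_nat p * u'"
    using assms by (elim cong_pE) blast
  then show ?thesis by (intro cong_pI[of _ _ "u + u'"]) (simp_all add: algebra_simps)
qed

lemma cong_p_integral: "x \<approx> y \<Longrightarrow> x \<in> p_integers" "x \<approx> y \<Longrightarrow> y \<in> p_integers"
  by (auto simp: cong_p_def)

lemma cong_p_minus: "x \<approx> y \<Longrightarrow> - x \<approx> - y"
  using cong_p_mult[OF cong_p_refl[OF of_int_p_integer[of "-1"]], of x y] by simp

lemma cong_p_diff: "x \<approx> y \<Longrightarrow> x' \<approx> y' \<Longrightarrow> x - x' \<approx> y - y'"
  using cong_p_add[of x y "- x'" "- y'"] cong_p_minus[of x' y'] by simp

lemma cong_p_power: "x \<approx> y \<Longrightarrow> x ^ n \<approx> y ^ n"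
  by (induction n) (auto intro: cong_p_mult)

lemma cong_p_sum: "(\<And>i. i \<in> A \<Longrightarrow> f i \<approx> g i) \<Longrightarrow> sum f A \<approx> sum g A"
  by (induction A rule: infinite_finite_induct) (auto intro: cong_p_add)

lemma cong_p_prod: "(\<And>i. i \<in> A \<Longrightarrow> f i \<approx> g i) \<Longrightarrow> prod f A \<approx> prod g A"
  by (induction A rule: infinite_finite_induct) (auto intro: cong_p_mult)

lemma cong_p_cancel:
  assumes "0 < k" "k < p" "of_nat k * x \<approx> of_nat k * y" shows "x \<approx> y"
proof -
  have "inverse (of_nat k) * (of_nat k * x) \<approx> inverse (of_nat k) * (of_nat k * y)"
    by (rule cong_p_mult[OF cong_p_refl[OF p_integer_inverse[OF assms(1,2)]] assms(3)])
  moreover have "inverse (of_nat k) * (of_nat k * u) = u" for u :: rat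
    using assms(1) by simp
  ultimately show ?thesis by simp
qed

lemma cong_p_inverse:
  assumes k: "0 < k" "k < p" and y: "of_nat k * y \<approx> 1" shows "inverse (of_nat k) \<approx> y"
proof (rule cong_p_cancel[OF k])
  show "of_nat k * inverse (of_nat k) \<approx> of_nat k * y" using cong_p_sym[OF y] k by simp
qed

lemma p_cong_0: "of_nat p \<approx> 0"
  by (rule cong_pI[of _ _ 1]) auto

lemma cong_imp_rat_cong: "x \<approx> y \<Longrightarrow> rat_cong p 1 x y"
proof -
  assume "x \<approx> y"
  then obtain a b where b: "\<not> int p dvd b" and eq: "x - y = of_nat p * (of_int a / of_int b)"
    unfolding cong_p_def p_integers_def by blast
  show "rat_cong p 1 x y"
  proof (cases "x = y")
    case False
    obtain n d where q: "quotient_of (x - y) = (n, d)" by force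
    have d: "d > 0" "coprime n d" and nd: "x - y = of_int n / of_int d"
      using q quotient_of_denom_pos quotient_of_coprime quotient_of_div by auto
    have "b \<noteq> 0" using b by auto
    have "(of_int (n * b) :: rat) = of_int (int p * a * d)"
      using nd eq d \<open>b \<noteq> 0\<close> by (simp add: field_simps)
    then have "n * b = int p * a * d" by (simp only: of_int_eq_iff)
    then have "int p dvd n * b" by simp
    then have "int p dvd n" using prime_p b by (simp add: prime_dvd_mult_iff)
    then have "\<not> int p dvd d"
      using coprime_common_divisor[OF d(2), of "int p"] prime_p by auto
    moreover have "n \<noteq> 0" using nd False d by auto
    then have "multiplicity (int p) n \<ge> 1"
      using \<open>int p dvd n\<close> prime_p by (intro multiplicity_geI) (auto simp: zdvd1_eq)
    ultimately show ?thesis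
      by (simp add: rat_cong_def padic_val_def q not_dvd_imp_multiplicity_0)
  qed (simp add: rat_cong_def)
qed

lemma h_pos: "0 < h"
  using prime_gt_1_nat[OF prime_p] p_eq by simp

lemma cong_p_half: "2 * x \<approx> 2 * y \<Longrightarrow> x \<approx> y"
  using cong_p_cancel[of 2 x y] h_pos p_eq by simp

lemma reflect_cong: "k \<le> p \<Longrightarrow> of_nat (p - k) \<approx> - of_nat k"
  using cong_p_diff[OF p_cong_0 cong_p_refl[of "of_nat k"]] by (simp add: of_nat_diff)

lemma inverse_reflect_cong:
  assumes "0 < k" "k < p" shows "inverse (of_nat (p - k)) \<approx> - inverse (of_nat k)"
proof (rule cong_p_inverse)
  have "of_nat (p - k) * - inverse (of_nat k) \<approx> - of_nat k * - inverse (of_nat k)"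
    using assms
    by (intro cong_p_mult[OF reflect_cong cong_p_refl]) (auto intro: p_integer_minus p_integer_inverse)
  then show "of_nat (p - k) * - inverse (of_nat k) \<approx> 1" using assms by simp
qed (use assms in auto)

lemma sum_reflect: "k \<le> p \<Longrightarrow> (\<Sum>j = p - k..p - 1. f j) = (\<Sum>j = 1..k. f (p - j))"
  by (rule sum.reindex_bij_witness[of _ "\<lambda>j. p - j" "\<lambda>j. p - j"]) (use p_eq in auto)

lemma sum_split_half: "(\<Sum>j = 1..p - 1. f j) = (\<Sum>j = 1..h. f j) + (\<Sum>j = 1..h. f (p - j))"
proof -
  have "{1..p - 1} = {1..h} \<union> {p - h..p - 1}" using p_eq by auto
  moreover have "{1..h} \<inter> {p - h..p - 1} = {}" using p_eq by auto
  ultimately have "(\<Sum>j = 1..p - 1. f j) = (\<Sum>j = 1..h. f j) + (\<Sum>j = p - h..p - 1. f j)"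
    by (simp add: sum.union_disjoint)
  then show ?thesis using sum_reflect[of h f] p_eq by simp
qed

lemma fermat_cong:
  assumes "0 < k" "k < p" shows "of_nat k ^ (p - 1) \<approx> 1"
proof -
  have "[k ^ (p - 1) = 1] (mod p)"
    using assms prime_p by (intro fermat_theorem) (auto dest: dvd_imp_le)
  then have "int p dvd int k ^ (p - 1) - 1"
    by (metis cong_iff_dvd_diff cong_int_iff of_nat_1 of_nat_power)
  then obtain z where "int k ^ (p - 1) - 1 = int p * z" by auto
  then have "(of_int (int k ^ (p - 1) - 1) :: rat) = of_int (int p * z)" by simp
  then show ?thesis
    by (intro cong_pI[of _ _ "of_int z"]) auto
qed

lemma inverse_power_cong:
  assumes "0 < k" "k < p" "s \<le> p - 1"
  shows "inverse (of_nat k) ^ s \<approx> of_nat k ^ (p - 1 - s)"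
proof -
  have "inverse (of_nat k) ^ s * of_nat k ^ (p - 1) \<approx> inverse (of_nat k) ^ s * 1"
    using assms
    by (intro cong_p_mult[OF cong_p_refl fermat_cong]) (auto intro: p_integer_power p_integer_inverse)
  moreover have "of_nat k ^ (p - 1) = of_nat k ^ s * (of_nat k ^ (p - 1 - s) :: rat)"
    using assms(3) power_add[of "of_nat k :: rat" s "p - 1 - s"] by (simp only: le_add_diff_inverse)
  then have "inverse (of_nat k) ^ s * of_nat k ^ (p - 1) = (of_nat k ^ (p - 1 - s) :: rat)"
    using assms(1) by (simp add: power_inverse flip: mult.assoc)
  ultimately show ?thesis by (auto intro: cong_p_sym)
qed

section \<open>Power sums modulo an odd prime\<close>

text \<open>
  The recurrence determines the Bernoulli number of index \<open>i\<close> after division by \<open>i + 1\<close>, which is a unit for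
  \<open>i + 1 < p\<close>.
\<close>

lemma bernoulli_p_integer: "i + 1 < p \<Longrightarrow> bernoulli i \<in> p_integers"
proof (induction i rule: less_induct)
  case (less i)
  have "of_nat (Suc i) * bernoulli i \<in> p_integers"
    unfolding bernoulli_recurrence
    using less by (intro p_integer_diff p_integer_sum p_integer_mult p_integer_power) auto
  then have "inverse (of_nat (Suc i)) * (of_nat (Suc i) * bernoulli i) \<in> p_integers"
    using less.prems by (intro p_integer_mult[OF p_integer_inverse]) auto
  moreover have "inverse (of_nat (Suc i)) * (of_nat (Suc i) * bernoulli i) = bernoulli i"
    by (metis left_inverse mult.assoc mult_1 of_nat_neq_0)
  ultimately show ?case by (simp only:)
qed

text \<open>
  For \<open>M < p - 1\<close>, every term of Faulhaber's formula for the sum over \<open>k < p\<close> contains a factor \<open>p\<close>, with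
  \<open>p\<close>-integral coefficients. Fermat's theorem settles \<open>M = p - 1\<close> and reduces the
  larger exponents to the smaller ones.
\<close>

lemma power_sum_cong:
  assumes "0 < M" "M < 2 * (p - 1)"
  shows "(\<Sum>k = 1..p - 1. of_nat k ^ M) \<approx> (if M = p - 1 then -1 else 0)"
proof -
  have small: "(\<Sum>k = 1..p - 1. of_nat k ^ M) \<approx> 0" if "0 < M" "M < p - 1" for M
  proof (rule cong_p_cancel)
    have "{..<p} = insert 0 {1..p - 1}" using p_eq by auto
    then have "(\<Sum>k = 1..p - 1. of_nat k ^ M) = (\<Sum>k<p. of_nat k ^ M :: rat)"
      using that by simp
    then have "of_nat (Suc M) * (\<Sum>k = 1..p - 1. of_nat k ^ M) =
        (\<Sum>i\<le>M. of_nat (Suc M choose i) * bernoulli i * of_nat p ^ (Suc M - i))"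
      by (simp only: sum_of_powers_bernoulli)
    also have "\<dots> \<approx> (\<Sum>i\<le>M. of_nat (Suc M choose i) * bernoulli i * 0)"
    proof (intro cong_p_sum cong_p_mult cong_p_refl)
      fix i assume "i \<in> {..M}"
      then show "bernoulli i \<in> p_integers" using that by (intro bernoulli_p_integer) auto
      show "of_nat p ^ (Suc M - i) \<approx> 0"
        using cong_p_power[OF p_cong_0, of "Suc M - i"] \<open>i \<in> {..M}\<close> by (simp add: Suc_diff_le)
    qed auto
    finally show "of_nat (Suc M) * (\<Sum>k = 1..p - 1. of_nat k ^ M) \<approx> of_nat (Suc M) * 0"
      by simp
  qed (use that in auto)
  consider "M < p - 1" | "M = p - 1" | "M > p - 1" by linarith
  then show ?thesis
  proof cases
    case 1
    then show ?thesis using small assms by simp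
  next
    case 2
    have "(\<Sum>k = 1..p - 1. of_nat k ^ (p - 1)) \<approx> (\<Sum>k = 1..p - 1. 1)"
      by (intro cong_p_sum fermat_cong) auto
    also have "(\<Sum>k = 1..p - 1. 1) = (of_nat p - 1 :: rat)"
      using p_eq by (simp add: of_nat_diff)
    also have "\<dots> \<approx> 0 - 1" by (intro cong_p_diff p_cong_0 cong_p_refl) auto
    finally show ?thesis using 2 by simp
  next
    case 3
    have "(\<Sum>k = 1..p - 1. of_nat k ^ M) = (\<Sum>k = 1..p - 1. of_nat k ^ (p - 1) * of_nat k ^ (M - (p - 1)))"
      using 3 by (simp flip: power_add)
    also have "\<dots> \<approx> (\<Sum>k = 1..p - 1. 1 * of_nat k ^ (M - (p - 1)))"
      by (intro cong_p_sum cong_p_mult fermat_cong cong_p_refl) auto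
    also have "\<dots> \<approx> 0" using small[of "M - (p - 1)"] 3 assms by simp
    finally show ?thesis using 3 by simp
  qed
qed

lemma inverse_power_sum_cong_0:
  assumes "0 < s" "s < p - 1"
  shows "(\<Sum>k = 1..p - 1. inverse (of_nat k) ^ s) \<approx> 0"
proof -
  have "(\<Sum>k = 1..p - 1. inverse (of_nat k) ^ s) \<approx> (\<Sum>k = 1..p - 1. of_nat k ^ (p - 1 - s))"
    using assms by (intro cong_p_sum inverse_power_cong) auto
  also have "\<dots> \<approx> (if p - 1 - s = p - 1 then -1 else 0)"
    using assms by (intro power_sum_cong) auto
  also have "\<dots> = 0" using assms by (intro if_not_P) linarith
  finally show ?thesis .
qed

lemma h_less_p: "h < p"
  using p_eq by simp

text \<open>
  Even powers are invariant under reflection, so the half range contributes half of the full sum.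
\<close>

lemma half_even_power_sum_cong_0:
  assumes "0 < c" "c < h"
  shows "(\<Sum>k = 1..h. inverse (of_nat k) ^ (2 * c)) \<approx> 0"
proof (rule cong_p_half)
  have "(\<Sum>k = 1..h. inverse (of_nat (p - k)) ^ (2 * c)) \<approx> (\<Sum>k = 1..h. (- inverse (of_nat k)) ^ (2 * c))"
    using p_eq by (intro cong_p_sum cong_p_power inverse_reflect_cong) auto
  then have "(\<Sum>k = 1..h. inverse (of_nat (p - k)) ^ (2 * c)) \<approx> (\<Sum>k = 1..h. inverse (of_nat k) ^ (2 * c))"
    by simp
  note reflected = this
  have "2 * (\<Sum>k = 1..h. inverse (of_nat k) ^ (2 * c)) \<approx>
      (\<Sum>k = 1..p - 1. inverse (of_nat k) ^ (2 * c))"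
    using cong_p_sym[OF cong_p_add[OF cong_p_refl[OF cong_p_integral(2)[OF reflected]] reflected]]
    unfolding sum_split_half by simp
  also have "\<dots> \<approx> 0" using assms p_eq by (intro inverse_power_sum_cong_0) auto
  finally show "2 * (\<Sum>k = 1..h. inverse (of_nat k) ^ (2 * c)) \<approx> 2 * 0" by simp
qed

section \<open>Double sums modulo an odd prime\<close>

text \<open>
  Both binomial coefficients become products of \<open>v\<close> factors after multiplication with \<open>v!\<close>, which is a
  unit; modulo \<open>p\<close> the upper entry is \<open>- u\<close>.
\<close>

lemma binomial_reflect_cong:
  assumes "u \<le> p" "v < p"
  shows "of_nat ((p - u) choose v) \<approx> (-1) ^ v * of_nat ((u + v - 1) choose v)"
proof -
  define F :: nat where "F = fact v"
  have F: "\<not> p dvd F" "F \<noteq> 0"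
    using assms prime_p by (simp_all add: F_def prime_dvd_fact_iff)
  have "fact v * of_nat ((p - u) choose v) = (\<Prod>i = 0..<v. of_nat (p - u) - of_nat i :: rat)"
    by (simp add: binomial_gbinomial gbinomial_prod_rev)
  also have "\<dots> \<approx> (\<Prod>i = 0..<v. - of_nat u - of_nat i)"
    using assms by (intro cong_p_prod cong_p_diff reflect_cong) auto
  also have "\<dots> = fact v * ((- of_nat u) gchoose v)"
    by (simp add: gbinomial_prod_rev)
  also have "((- of_nat u) gchoose v) = (-1) ^ v * (of_nat ((u + v - 1) choose v) :: rat)"
  \<comment> \<open>For \<open>u = v = 0\<close> the subtraction is truncated, and both sides are 1.\<close>
  proof (cases "u + v = 0")
    case False
    then have "of_nat u + of_nat v - 1 = (of_nat (u + v - 1) :: rat)"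
      by (subst of_nat_diff) auto
    then show ?thesis by (simp only: gbinomial_minus binomial_gbinomial)
  qed simp
  finally have *: "of_nat F * of_nat ((p - u) choose v) \<approx>
      of_nat F * ((-1) ^ v * of_nat ((u + v - 1) choose v))"
    by (simp only: F_def of_nat_fact)
  have "inverse (of_nat F) \<in> p_integers"
    using F by (intro p_integersI[of "int F" _ 1]) (simp_all add: inverse_eq_divide)
  from cong_p_mult[OF cong_p_refl[OF this] *]
  have "inverse (of_nat F) * (of_nat F * of_nat ((p - u) choose v)) \<approx>
      inverse (of_nat F) * (of_nat F * ((-1) ^ v * of_nat ((u + v - 1) choose v)))" .
  moreover have "inverse (of_nat F) * (of_nat F * q) = q" for q :: rat
    using F by simp
  ultimately show ?thesis by (simp only:)
qed

text \<open>
  The inverse powers are replaced by positive powers by Fermat's theorem. Faulhaber's formula then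
  evaluates the inner sum as a polynomial in \<open>j\<close>, and summing over all residues \<open>j\<close> picks out the single
  monomial whose total exponent is \<open>p - 1\<close>. It carries the Bernoulli number on the right.
\<close>

lemma full_double_sum_cong:
  assumes "0 < x" "2 * x + 2 * y + 1 < p"
  shows "of_nat (2 * x) * double_sum (p - 1) (2 * x) (2 * y + 1) \<approx>
    - (of_nat ((2 * x + 2 * y) choose (2 * y + 1)) * bernoulli (p - (2 * x + 2 * y + 1)))"
proof -
  \<comment> \<open>By Fermat's theorem, \<open>m ^ N\<close> and \<open>j ^ e\<close> stand for the inverses of \<open>m ^ (2 * x)\<close> and \<open>j ^ (2 * y + 1)\<close>.\<close>
  define N e where "N = p - 1 - 2 * x" and "e = p - 1 - (2 * y + 1)"
  define i0 where "i0 = p - (2 * x + 2 * y + 1)"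
  define D where "D = double_sum (p - 1) (2 * x) (2 * y + 1)"
  have N: "0 < N" "Suc N = p - 2 * x" "i0 \<le> N"
    using assms by (auto simp: N_def i0_def)
  have bern: "bernoulli i \<in> p_integers" if "i \<le> N" for i
    using that assms by (intro bernoulli_p_integer) (auto simp: N_def)
  have "D \<approx> (\<Sum>j = 1..p - 1. of_nat j ^ e * (\<Sum>m = 1..<j. of_nat m ^ N))"
    unfolding D_def double_sum_def N_def e_def using assms
    by (intro cong_p_sum cong_p_mult inverse_power_cong) auto
  also have "\<dots> = (\<Sum>j = 1..p - 1. of_nat j ^ e * (\<Sum>m<j. of_nat m ^ N))"
  proof (rule sum.cong[OF refl])
    fix j assume "j \<in> {1..p - 1}"
    \<comment> \<open>Faulhaber's formula starts at \<open>m = 0\<close>, which contributes \<open>0 ^ N = 0\<close>.\<close>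
    then have "{..<j} = insert 0 {1..<j}" by auto
    then show "of_nat j ^ e * (\<Sum>m = 1..<j. of_nat m ^ N) =
        (of_nat j ^ e * (\<Sum>m<j. of_nat m ^ N) :: rat)" using N by simp
  qed
  finally have D: "D \<approx> (\<Sum>j = 1..p - 1. of_nat j ^ e * (\<Sum>m<j. of_nat m ^ N))" .
  then have "of_nat (Suc N) * D \<approx>
      of_nat (Suc N) * (\<Sum>j = 1..p - 1. of_nat j ^ e * (\<Sum>m<j. of_nat m ^ N))"
    by (intro cong_p_mult cong_p_refl) auto
  also have "\<dots> = (\<Sum>j = 1..p - 1. of_nat j ^ e * (of_nat (Suc N) * (\<Sum>m<j. of_nat m ^ N)))"
    by (simp only: sum_distrib_left mult.left_commute)
  also have "\<dots> = (\<Sum>j = 1..p - 1. \<Sum>i\<le>N.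
      of_nat (Suc N choose i) * bernoulli i * of_nat j ^ (e + (Suc N - i)))"
    unfolding sum_of_powers_bernoulli
    by (simp only: sum_distrib_left mult.left_commute power_add)
  also have "\<dots> = (\<Sum>i\<le>N. of_nat (Suc N choose i) * bernoulli i *
      (\<Sum>j = 1..p - 1. of_nat j ^ (e + (Suc N - i))))"
    by (subst sum.swap) (simp only: sum_distrib_left)
  also have "\<dots> \<approx> (\<Sum>i\<le>N. of_nat (Suc N choose i) * bernoulli i *
      (if e + (Suc N - i) = p - 1 then -1 else 0))"
    using assms bern by (intro cong_p_sum cong_p_mult power_sum_cong) (auto simp: N_def e_def)
  also have "\<dots> = (\<Sum>i\<le>N. if i = i0 then - of_nat (Suc N choose i) * bernoulli i else 0)"
    using assms by (intro sum.cong) (auto simp: N_def e_def i0_def)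
  also have "\<dots> = - (of_nat (Suc N choose i0) * bernoulli i0)"
    using N by simp
  also have "Suc N choose i0 = (p - 2 * x) choose (2 * y + 1)"
    using N assms by (subst binomial_symmetric) (auto simp: i0_def)
  also have "- (of_nat \<dots> * bernoulli i0) \<approx>
      - ((-1) ^ (2 * y + 1) * of_nat ((2 * x + (2 * y + 1) - 1) choose (2 * y + 1)) * bernoulli i0)"
    using assms N bern by (intro cong_p_minus cong_p_mult binomial_reflect_cong cong_p_refl) auto
  finally have 1: "of_nat (Suc N) * D \<approx> of_nat ((2 * x + 2 * y) choose (2 * y + 1)) * bernoulli i0"
    by (simp del: of_nat_Suc binomial_Suc_Suc)
  \<comment> \<open>\<open>Suc N = p - 2 * x\<close>, so the factor on the left is \<open>- 2 * x\<close> modulo \<open>p\<close>.\<close>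
  have "of_nat (Suc N) * D \<approx> - of_nat (2 * x) * D"
    unfolding N(2) using assms cong_p_integral(1)[OF D]
    by (intro cong_p_mult reflect_cong cong_p_refl) auto
  from cong_p_minus[OF cong_p_trans[OF cong_p_sym[OF this] 1]]
  show ?thesis by (simp add: D_def i0_def)
qed

text \<open>
  Write \<open>D\<^sub>n\<close> for the double sum up to \<open>n\<close> and \<open>e = 2 x\<close>, \<open>t = 2 y + 1\<close>. Reflecting the indices
  \<open>j > h\<close> and using that the full sum of the \<open>m\<^sup>-\<^sup>e\<close> vanishes gives \<open>2 D\<^sub>h(e, t)\<close> plus the diagonal sum; here the
  signs work out because \<open>e\<close> is even and \<open>t\<close> is odd. The product formula for two single sums, one
  of which vanishes, replaces \<open>D\<^sub>h(e, t)\<close> by \<open>- D\<^sub>h(t, e)\<close> minus the diagonal sum.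
\<close>

lemma full_double_sum_eq_half_double_sum:
  assumes "0 < x" "2 * x + 2 * y + 1 < p"
  shows "double_sum (p - 1) (2 * x) (2 * y + 1) \<approx>
    - 2 * double_sum h (2 * y + 1) (2 * x) - (\<Sum>j = 1..h. inverse (of_nat j) ^ (2 * x + 2 * y + 1))"
proof -
  define f where "f s j = (inverse (of_nat j) ^ s :: rat)" for s j
  define e t where "e = 2 * x" and "t = 2 * y + 1"
  have f_int: "f s j \<in> p_integers" if "0 < j" "j < p" for s j
    using that by (simp add: f_def p_integer_inverse)
  have tail: "(\<Sum>m = 1..<p - j. f e m) \<approx> - (\<Sum>m = 1..j. f e m)" if "1 \<le> j" "j \<le> h" for j
  proof -
    have j: "j < p" using that p_eq by simp
    have "{1..p - 1} = {1..<p - j} \<union> {p - j..p - 1}" using that j by auto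
    moreover have "{1..<p - j} \<inter> {p - j..p - 1} = {}" by auto
    ultimately have "(\<Sum>m = 1..<p - j. f e m) + (\<Sum>m = p - j..p - 1. f e m) = (\<Sum>m = 1..p - 1. f e m)"
      by (simp add: sum.union_disjoint)
    also have "\<dots> \<approx> 0"
      unfolding f_def e_def using assms by (intro inverse_power_sum_cong_0) auto
    finally have 1: "(\<Sum>m = 1..<p - j. f e m) + (\<Sum>m = 1..j. f e (p - m)) \<approx> 0"
      using sum_reflect[of j "f e"] j by simp
    have "(\<Sum>m = 1..j. f e (p - m)) \<approx> (\<Sum>m = 1..j. (- inverse (of_nat m)) ^ e)"
      unfolding f_def using j by (intro cong_p_sum cong_p_power inverse_reflect_cong) auto
    then have 2: "(\<Sum>m = 1..j. f e (p - m)) \<approx> (\<Sum>m = 1..j. f e m)"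
      by (simp add: f_def e_def)
    from cong_p_diff[OF 1 2] show ?thesis by simp
  qed
  have "(\<Sum>j = 1..h. f t (p - j) * (\<Sum>m = 1..<p - j. f e m)) \<approx>
      (\<Sum>j = 1..h. (- inverse (of_nat j)) ^ t * - (\<Sum>m = 1..j. f e m))"
    unfolding f_def[of t] using p_eq
    by (intro cong_p_sum cong_p_mult cong_p_power inverse_reflect_cong tail) auto
  also have "\<dots> = (\<Sum>j = 1..h. f t j * (\<Sum>m = 1..<j. f e m) + f (t + e) j)"
  proof (intro sum.cong refl)
    fix j assume "j \<in> {1..h}"
    then have "{1..j} = insert j {1..<j}" by auto
    then show "(- inverse (of_nat j)) ^ t * - (\<Sum>m = 1..j. f e m) =
        f t j * (\<Sum>m = 1..<j. f e m) + f (t + e) j"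
      by (simp add: f_def t_def power_add algebra_simps)
  qed
  also have "\<dots> = double_sum h e t + (\<Sum>j = 1..h. f (t + e) j)"
    by (simp add: double_sum_def f_def sum.distrib)
  finally have upper: "(\<Sum>j = 1..h. f t (p - j) * (\<Sum>m = 1..<p - j. f e m)) \<approx>
      double_sum h e t + (\<Sum>j = 1..h. f (t + e) j)" .
  have D_int: "double_sum h s s' \<in> p_integers" for s s'
    unfolding double_sum_def f_def[symmetric] using p_eq
    by (intro p_integer_sum p_integer_mult f_int) auto
  have "double_sum (p - 1) e t =
      double_sum h e t + (\<Sum>j = 1..h. f t (p - j) * (\<Sum>m = 1..<p - j. f e m))"
    by (simp only: double_sum_def sum_split_half f_def)
  also have "\<dots> \<approx> double_sum h e t + (double_sum h e t + (\<Sum>j = 1..h. f (t + e) j))"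
    by (rule cong_p_add[OF cong_p_refl[OF D_int] upper])
  finally have full: "double_sum (p - 1) e t \<approx>
      double_sum h e t + (double_sum h e t + (\<Sum>j = 1..h. f (t + e) j))" .
  have "(\<Sum>j = 1..h. f t j) \<in> p_integers"
    using p_eq by (intro p_integer_sum f_int) auto
  then have "(\<Sum>j = 1..h. f e j) * (\<Sum>j = 1..h. f t j) \<approx> 0 * (\<Sum>j = 1..h. f t j)"
    unfolding f_def e_def using assms p_eq
    by (intro cong_p_mult[OF _ cong_p_refl] half_even_power_sum_cong_0) auto
  then have stuffle: "double_sum h e t + double_sum h t e + (\<Sum>j = 1..h. f (e + t) j) \<approx> 0"
    unfolding f_def sum_mult_sum_eq_double_sums by simp
  have "double_sum (p - 1) e t \<approx>
      - 2 * double_sum h t e - (\<Sum>j = 1..h. f (e + t) j)"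
  proof -
    \<comment> \<open>Subtracting the vanishing product twice cancels both copies of \<open>double_sum h e t\<close>.\<close>
    have "double_sum (p - 1) e t - (0 + 0) \<approx>
        double_sum h e t + (double_sum h e t + (\<Sum>j = 1..h. f (t + e) j)) -
        (double_sum h e t + double_sum h t e + (\<Sum>j = 1..h. f (e + t) j) +
         (double_sum h e t + double_sum h t e + (\<Sum>j = 1..h. f (e + t) j)))"
      by (rule cong_p_diff[OF full cong_p_sym[OF cong_p_add[OF stuffle stuffle]]])
    then show ?thesis
      by (simp add: add.commute[of t e] algebra_simps)
  qed
  then show ?thesis by (simp add: e_def t_def f_def)
qed

section \<open>Star sums over the half range\<close>

text \<open>
  For \<open>n = h\<close> numerator and denominator of each factor, \<open>h - i\<close> and \<open>h + i + 1\<close>, add up to \<open>p\<close>.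
\<close>

lemma star_kernel_half_cong:
  assumes "j \<le> h" shows "star_kernel h j \<approx> -2"
proof -
  have "- ((of_nat h - of_nat i) / (of_nat h + of_nat i + 1)) \<approx> 1" if "i < j" for i
  proof -
    have k: "0 < h + i + 1" "h + i + 1 < p" "h - i \<le> p" "p - (h - i) = h + i + 1"
      using that assms p_eq by auto
    define K :: rat where "K = of_nat (h + i + 1)"
    have "K * inverse K \<approx> - of_nat (h - i) * inverse K"
      unfolding K_def using reflect_cong[OF k(3)] k
      by (intro cong_p_mult[OF _ cong_p_refl[OF p_integer_inverse]]) (simp_all only:)
    moreover have "K * inverse K = 1"
      by (rule right_inverse) (simp only: K_def of_nat_eq_0_iff)
    ultimately have "- of_nat (h - i) * inverse K \<approx> 1"
      by (simp only: cong_p_sym)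
    moreover have "of_nat (h - i) = (of_nat h - of_nat i :: rat)"
      using that assms by (simp add: of_nat_diff)
    ultimately show ?thesis
      by (simp only: K_def of_nat_add of_nat_1 divide_inverse mult_minus_left)
  qed
  then have "star_kernel h j \<approx> -2 * (\<Prod>i<j. 1)"
    unfolding star_kernel_def by (intro cong_p_mult cong_p_prod cong_p_refl) auto
  then show ?thesis by simp
qed

lemma half_star_sum_2s_cong_0:
  assumes "0 < c" "c < h" shows "star_sum 1 h (replicate c 2) \<approx> 0"
proof -
  have "kernel_transform h (\<lambda>j. inverse (of_nat j) ^ (2 * c)) \<approx>
      (\<Sum>j = 1..h. -2 * inverse (of_nat j) ^ (2 * c))"
    unfolding kernel_transform_def using p_eq
    by (intro cong_p_sum cong_p_mult star_kernel_half_cong cong_p_refl p_integer_power p_integer_inverse) auto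
  also have "\<dots> = -2 * (\<Sum>j = 1..h. inverse (of_nat j) ^ (2 * c))"
    by (rule sum_distrib_left[symmetric])
  also have "\<dots> \<approx> -2 * 0"
    using assms by (intro cong_p_mult half_even_power_sum_cong_0 cong_p_refl) auto
  finally show ?thesis using h_pos by (simp only: star_sum_2s mult_zero_right)
qed

text \<open>
  The constant kernel turns the transform in \<open>star_sum_2s_3_2s\<close> into a double sum over the half range
  plus a diagonal, which is twice the double sum over the full range.
\<close>

lemma half_star_sum_2s_3_2s_cong:
  assumes "2 * a + 2 * b + 3 < p"
  shows "of_nat (b + 1) * star_sum 1 h (replicate a 2 @ 3 # replicate b 2) \<approx>
    - (of_nat ((2 * a + 2 * b + 2) choose (2 * a + 1)) * bernoulli (p - (2 * a + 2 * b + 3)))"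
proof -
  define f where "f s j = (inverse (of_nat j) ^ s :: rat)" for s j
  define D where "D = double_sum (p - 1) (2 * (b + 1)) (2 * a + 1)"
  have f_int: "f s j \<in> p_integers" if "0 < j" "j < p" for s j
    using that by (simp add: f_def p_integer_inverse)
  have eq: "star_sum 1 h (replicate a 2 @ 3 # replicate b 2) =
      kernel_transform h (\<lambda>j. f (2 * b + 2) j * (f (2 * a + 1) j + 2 * (\<Sum>m = 1..<j. f (2 * a + 1) m)))"
    by (simp only: star_sum_2s_3_2s f_def)
  have "star_sum 1 h (replicate a 2 @ 3 # replicate b 2) \<approx> (\<Sum>j = 1..h. -2 * (f (2 * b + 2) j *
      (f (2 * a + 1) j + 2 * (\<Sum>m = 1..<j. f (2 * a + 1) m))))"
    unfolding eq kernel_transform_def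
  proof (rule cong_p_sum)
    fix j assume j: "j \<in> {1..h}"
    then have "f (2 * b + 2) j \<in> p_integers" "f (2 * a + 1) j \<in> p_integers"
      using h_less_p by (auto intro: f_int)
    moreover have "(\<Sum>m = 1..<j. f (2 * a + 1) m) \<in> p_integers"
      using j h_less_p by (intro p_integer_sum f_int) auto
    ultimately have "f (2 * b + 2) j * (f (2 * a + 1) j + 2 * (\<Sum>m = 1..<j. f (2 * a + 1) m)) \<in> p_integers"
      by (intro p_integer_mult p_integer_add numeral_p_integer)
    then show "star_kernel h j * (f (2 * b + 2) j * (f (2 * a + 1) j + 2 * (\<Sum>m = 1..<j. f (2 * a + 1) m))) \<approx>
        -2 * (f (2 * b + 2) j * (f (2 * a + 1) j + 2 * (\<Sum>m = 1..<j. f (2 * a + 1) m)))"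
      using j by (intro cong_p_mult[OF star_kernel_half_cong cong_p_refl]) auto
  qed
  also have "\<dots> = (\<Sum>j = 1..h. 2 * (- 2 * (f (2 * (b + 1)) j * (\<Sum>m = 1..<j. f (2 * a + 1) m)) -
      f (2 * (b + 1) + 2 * a + 1) j))"
  proof (rule sum.cong[OF refl])
    fix j
    define A where "A = f (2 * b + 2) j"
    define B where "B = f (2 * a + 1) j"
    define C where "C = (\<Sum>m = 1..<j. f (2 * a + 1) m)"
    have "f (2 * (b + 1)) j = A"
      by (simp add: A_def)
    moreover have "f (2 * (b + 1) + 2 * a + 1) j = A * B"
      using power_add[of "inverse (of_nat j :: rat)" "2 * b + 2" "2 * a + 1"]
      by (simp add: A_def B_def f_def)
    moreover have "-2 * (A * (B + 2 * C)) = 2 * (- 2 * (A * C) - A * B)"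
      by (simp add: algebra_simps)
    ultimately show "-2 * (f (2 * b + 2) j * (f (2 * a + 1) j + 2 * (\<Sum>m = 1..<j. f (2 * a + 1) m))) =
        2 * (- 2 * (f (2 * (b + 1)) j * (\<Sum>m = 1..<j. f (2 * a + 1) m)) -
          f (2 * (b + 1) + 2 * a + 1) j)"
      by (simp only: A_def B_def C_def)
  qed
  also have "\<dots> = 2 * (- 2 * double_sum h (2 * a + 1) (2 * (b + 1)) -
      (\<Sum>j = 1..h. f (2 * (b + 1) + 2 * a + 1) j))"
    by (simp only: double_sum_def f_def sum_distrib_left[symmetric] sum_subtractf)
  also have "\<dots> \<approx> 2 * D"
    unfolding D_def f_def using assms
    by (intro cong_p_mult[OF cong_p_refl] cong_p_sym[OF full_double_sum_eq_half_double_sum]) auto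
  finally have "of_nat (b + 1) * star_sum 1 h (replicate a 2 @ 3 # replicate b 2) \<approx>
      of_nat (b + 1) * (2 * D)"
    by (intro cong_p_mult[OF cong_p_refl]) (simp_all only: of_nat_p_integer)
  also have "\<dots> = of_nat (2 * (b + 1)) * D" by simp
  also have "\<dots> \<approx> - (of_nat ((2 * (b + 1) + 2 * a) choose (2 * a + 1)) *
      bernoulli (p - (2 * (b + 1) + 2 * a + 1)))"
    unfolding D_def using assms by (intro full_double_sum_cong) auto
  also have "2 * (b + 1) + 2 * a = 2 * a + 2 * b + 2" by simp
  finally show ?thesis by (simp add: eval_nat_numeral)
qed

section \<open>From the half range to the full range\<close>

text \<open>
  Coefficients from \<open>h\<close> on are ignored: up to \<open>h\<close>, the star sum over \<open>{2}\<^sup>a\<close> vanishes modulo \<open>p\<close> for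
  \<open>0 < a < h\<close>, but it is 1 for \<open>a = h\<close>.
\<close>

definition fps_cong :: "rat fps \<Rightarrow> rat fps \<Rightarrow> bool" where
  "fps_cong f g \<longleftrightarrow> (\<forall>i<h. fps_nth f i \<approx> fps_nth g i)"

lemma fps_cong_sym: "fps_cong f g \<Longrightarrow> fps_cong g f"
  by (auto simp: fps_cong_def intro: cong_p_sym)

lemma fps_cong_trans [trans]: "fps_cong f g \<Longrightarrow> fps_cong g k \<Longrightarrow> fps_cong f k"
  by (auto simp: fps_cong_def intro: cong_p_trans)

lemma fps_cong_one: "fps_cong 1 1"
  by (auto simp: fps_cong_def)

lemma fps_cong_mult: "fps_cong f g \<Longrightarrow> fps_cong f' g' \<Longrightarrow> fps_cong (f * f') (g * g')"
  by (auto simp: fps_cong_def fps_mult_nth intro!: cong_p_sum cong_p_mult)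

lemma fps_cong_prod: "(\<And>i. i \<in> A \<Longrightarrow> fps_cong (f i) (g i)) \<Longrightarrow> fps_cong (prod f A) (prod g A)"
  by (induction A rule: infinite_finite_induct) (auto intro: fps_cong_mult fps_cong_one)

definition star_fps :: "nat set \<Rightarrow> rat fps" where
  "star_fps A = (\<Prod>j\<in>A. geometric_fps (inverse (of_nat j) ^ 2))"

definition strict_fps :: "nat set \<Rightarrow> rat fps" where
  "strict_fps A = (\<Prod>j\<in>A. 1 - fps_const (inverse (of_nat j) ^ 2) * fps_X)"

lemma star_fps_nth: "fps_nth (star_fps {l..n}) a = star_sum l n (replicate a 2)"
  by (simp add: star_fps_def flip: star_sum_fps)

lemma strict_fps_nth: "fps_nth (strict_fps {l..n}) a = (-1) ^ a * strict_sum l n (replicate a 2)"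
  by (simp add: strict_fps_def flip: strict_sum_fps)

lemma star_fps_strict_fps: "star_fps A * strict_fps A = 1"
  by (simp add: star_fps_def strict_fps_def geometric_fps_inverse flip: prod.distrib)

lemma star_fps_union:
  "finite A \<Longrightarrow> finite B \<Longrightarrow> A \<inter> B = {} \<Longrightarrow> star_fps (A \<union> B) = star_fps A * star_fps B"
  by (simp add: star_fps_def prod.union_disjoint)

lemma strict_fps_union:
  "finite A \<Longrightarrow> finite B \<Longrightarrow> A \<inter> B = {} \<Longrightarrow> strict_fps (A \<union> B) = strict_fps A * strict_fps B"
  by (simp add: strict_fps_def prod.union_disjoint)

lemma geometric_fps_cong: "x \<approx> y \<Longrightarrow> fps_cong (geometric_fps x) (geometric_fps y)"
  by (auto simp: fps_cong_def geometric_fps_def intro: cong_p_power)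

lemma inverse_square_p_integer:
  assumes "A \<subseteq> {1..p - 1}" "j \<in> A" shows "inverse (of_nat j) ^ 2 \<in> p_integers"
proof -
  have "j \<in> {1..p - 1}" using assms by blast
  then show ?thesis by (intro p_integer_power p_integer_inverse) auto
qed

lemma star_fps_cong_refl: "A \<subseteq> {1..p - 1} \<Longrightarrow> fps_cong (star_fps A) (star_fps A)"
  unfolding star_fps_def
  by (intro fps_cong_prod geometric_fps_cong cong_p_refl inverse_square_p_integer)

lemma strict_fps_cong_refl:
  assumes "A \<subseteq> {1..p - 1}" shows "fps_cong (strict_fps A) (strict_fps A)"
  unfolding strict_fps_def
proof (intro fps_cong_prod)
  fix j assume "j \<in> A"
  then show "fps_cong (1 - fps_const (inverse (of_nat j) ^ 2) * fps_X)
      (1 - fps_const (inverse (of_nat j) ^ 2) * fps_X)"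
    using inverse_square_p_integer[OF assms]
    by (auto simp: fps_cong_def fps_one_nth fps_X_def simp del: power_inverse)
qed

lemma star_fps_reflect:
  assumes "A \<subseteq> {1..p - 1}"
  shows "fps_cong (star_fps ((\<lambda>j. p - j) ` A)) (star_fps A)"
proof -
  have inj: "inj_on (\<lambda>j. p - j) A"
    by (rule inj_on_subset[OF _ assms]) (auto simp: inj_on_def)
  have "0 < j \<and> j < p" if "j \<in> A" for j
    using assms that by (force dest: subsetD)
  then have "fps_cong (\<Prod>j\<in>A. geometric_fps (inverse (of_nat (p - j)) ^ 2))
      (\<Prod>j\<in>A. geometric_fps ((- inverse (of_nat j)) ^ 2))"
    by (intro fps_cong_prod geometric_fps_cong cong_p_power inverse_reflect_cong) blast+
  then show ?thesis
    by (simp add: star_fps_def prod.reindex[OF inj])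
qed

lemma image_reflect:
  assumes "l \<le> m" "m \<le> p" shows "(\<lambda>j. p - j) ` {l..m} = {p - m..p - l}"
proof (intro equalityI subsetI)
  fix i assume "i \<in> {p - m..p - l}"
  then show "i \<in> (\<lambda>j. p - j) ` {l..m}"
    using assms by (intro image_eqI[of _ _ "p - i"]) auto
qed (use assms in auto)

text \<open>
  This is where the vanishing of the sums over \<open>{2}\<^sup>a\<close> enters: indices may be added to a range or
  removed from it by complete halves without changing the generating function modulo \<open>p\<close>. The
  following lemmas combine this with reflection.
\<close>

lemma star_fps_half: "fps_cong (star_fps {1..h}) 1"
  unfolding fps_cong_def star_fps_nth
proof (intro allI impI)
  fix i assume "i < h"
  then show "star_sum 1 h (replicate i 2) \<approx> fps_nth 1 i"
    using half_star_sum_2s_cong_0[of i] by (cases "i = 0") auto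
qed

lemma star_fps_upper_half: "fps_cong (star_fps {h + 1..p - 1}) 1"
proof -
  have "(\<lambda>j. p - j) ` {1..h} = {h + 1..p - 1}"
    using image_reflect[of 1 h] h_pos p_eq by simp
  moreover have "{1..h} \<subseteq> {1..p - 1}" using p_eq by auto
  ultimately have "fps_cong (star_fps {h + 1..p - 1}) (star_fps {1..h})"
    using star_fps_reflect[of "{1..h}"] by simp
  also note star_fps_half
  finally show ?thesis .
qed

lemma star_fps_to_half:
  assumes "1 \<le> k" "k \<le> h"
  shows "fps_cong (star_fps {k..p - 1}) (star_fps {k..h})"
proof -
  have "{k..p - 1} = {k..h} \<union> {h + 1..p - 1}" using assms p_eq by auto
  then have "star_fps {k..p - 1} = star_fps {k..h} * star_fps {h + 1..p - 1}"
    by (simp add: star_fps_union)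
  also have "fps_cong \<dots> (star_fps {k..h} * 1)"
    using assms h_less_p by (intro fps_cong_mult star_fps_upper_half star_fps_cong_refl) auto
  finally show ?thesis by simp
qed

lemma star_fps_initial_reflect:
  assumes "1 \<le> k" "k \<le> h"
  shows "fps_cong (star_fps {1..p - k}) (star_fps {k..h})"
proof -
  have "(\<lambda>j. p - j) ` {k..p - 1} = {1..p - k}"
    using image_reflect[of k "p - 1"] assms p_eq by simp
  then have "fps_cong (star_fps {1..p - k}) (star_fps {k..p - 1})"
    using star_fps_reflect[of "{k..p - 1}"] assms by auto
  also note star_fps_to_half[OF assms]
  finally show ?thesis .
qed

lemma star_fps_final_reflect:
  assumes "1 \<le> k" "k \<le> h"
  shows "fps_cong (star_fps {p - k..p - 1}) (star_fps {1..k})"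
proof -
  have "(\<lambda>j. p - j) ` {1..k} = {p - k..p - 1}"
    using image_reflect[of 1 k] assms p_eq by simp
  moreover have "{1..k} \<subseteq> {1..p - 1}" using assms p_eq by auto
  ultimately show ?thesis
    using star_fps_reflect[of "{1..k}"] by simp
qed

text \<open>
  Let \<open>k\<close> be the index of the exponent 3. If \<open>k \<le> h\<close>, the indices above \<open>h\<close> can be dropped. If \<open>k > h\<close>, the
  indices below \<open>h + 1\<close> can be dropped, and reflection reverses the chain, which interchanges \<open>a\<close> and \<open>b\<close>
  and changes the sign because 3 is odd.
\<close>

lemma star_sum_2s_3_2s_split_half:
  assumes "a < h" "b < h"
  shows "star_sum 1 (p - 1) (replicate a 2 @ 3 # replicate b 2) \<approx>
    star_sum 1 h (replicate a 2 @ 3 # replicate b 2) - star_sum 1 h (replicate b 2 @ 3 # replicate a 2)"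
proof -
  define L where "L l n c = fps_nth (star_fps {l..n}) c" for l n c
  define f where "f k = (inverse (of_nat k) ^ 3 :: rat)" for k
  have L_cong: "L l n c \<approx> L l' n' c"
    if "fps_cong (star_fps {l..n}) (star_fps {l'..n'})" "c < h" for l n l' n' c
    using that by (simp add: L_def fps_cong_def)
  have eq: "star_sum 1 n (replicate c 2 @ 3 # replicate d 2) =
      (\<Sum>k = 1..n. L 1 k c * f k * L k n d)" for n c d
    by (simp only: star_sum_append L_def star_fps_nth f_def)
  have lower: "(\<Sum>k = 1..h. L 1 k a * f k * L k (p - 1) b) \<approx> (\<Sum>k = 1..h. L 1 k a * f k * L k h b)"
  proof (intro cong_p_sum cong_p_mult)
    fix k assume k: "k \<in> {1..h}"
    show "L 1 k a \<approx> L 1 k a"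
      using k assms h_less_p by (intro L_cong star_fps_cong_refl) auto
    show "L k (p - 1) b \<approx> L k h b"
      using k assms by (intro L_cong star_fps_to_half) auto
    show "f k \<approx> f k"
      unfolding f_def using k h_less_p by (intro cong_p_refl p_integer_power p_integer_inverse) auto
  qed
  have "(\<Sum>k = 1..h. L 1 (p - k) a * f (p - k) * L (p - k) (p - 1) b) \<approx>
      (\<Sum>k = 1..h. L k h a * (- inverse (of_nat k)) ^ 3 * L 1 k b)"
  proof (intro cong_p_sum cong_p_mult)
    fix k assume k: "k \<in> {1..h}"
    show "L 1 (p - k) a \<approx> L k h a"
      using k assms by (intro L_cong star_fps_initial_reflect) auto
    show "L (p - k) (p - 1) b \<approx> L 1 k b"
      using k assms by (intro L_cong star_fps_final_reflect) auto
    show "f (p - k) \<approx> (- inverse (of_nat k)) ^ 3"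
      unfolding f_def using k h_less_p by (intro cong_p_power inverse_reflect_cong) auto
  qed
  also have "\<dots> = - (\<Sum>k = 1..h. L 1 k b * f k * L k h a)"
    unfolding sum_negf[symmetric] by (rule sum.cong) (simp_all add: f_def)
  finally have "(\<Sum>k = 1..h. L 1 (p - k) a * f (p - k) * L (p - k) (p - 1) b) \<approx>
      - (\<Sum>k = 1..h. L 1 k b * f k * L k h a)" .
  from cong_p_add[OF lower this] show ?thesis
    unfolding eq sum_split_half by simp
qed

lemma strict_fps_full: "fps_cong (strict_fps {1..p - 1}) 1"
proof -
  have "fps_cong (star_fps {1..p - 1}) 1"
    using fps_cong_trans[OF star_fps_to_half[of 1] star_fps_half] h_pos by simp
  from fps_cong_mult[OF fps_cong_sym[OF this] strict_fps_cong_refl[of "{1..p - 1}"]]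
  show ?thesis by (simp add: star_fps_strict_fps)
qed

text \<open>
  The strict generating function of the full range is 1 modulo \<open>p\<close>, so that of \<open>A\<close> is inverse to that
  of \<open>B\<close>, and so is the star generating function of \<open>B\<close>.
\<close>

lemma strict_fps_complement:
  assumes "A \<union> B = {1..p - 1}" "A \<inter> B = {}"
  shows "fps_cong (strict_fps A) (star_fps B)"
proof -
  have fin: "finite A" "finite B"
    using assms(1) by (metis finite_Un finite_atLeastAtMost)+
  have "strict_fps A = strict_fps {1..p - 1} * star_fps B"
    unfolding assms(1)[symmetric] strict_fps_union[OF fin assms(2)]
    using star_fps_strict_fps[of B] by (simp add: mult.assoc mult.commute[of "strict_fps B"])
  also have "fps_cong \<dots> (1 * star_fps B)"
    using assms by (intro fps_cong_mult strict_fps_full star_fps_cong_refl) auto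
  finally show ?thesis by simp
qed

text \<open>
  With the exponent 3 at \<open>k\<close>, the strict sums run over the indices below and above \<open>k\<close>; by
  \<open>strict_fps_complement\<close> they become star sums over \<open>k..p - 1\<close> and \<open>1..k\<close>, which occur in a star sum with
  the two blocks of twos interchanged.
\<close>

lemma strict_sum_2s_3_2s_cong_star_sum:
  assumes "a < h" "b < h"
  shows "strict_sum 1 (p - 1) (replicate a 2 @ 3 # replicate b 2) \<approx>
    (-1) ^ (a + b) * star_sum 1 (p - 1) (replicate b 2 @ 3 # replicate a 2)"
proof -
  have strict: "strict_sum l n (replicate c 2) \<approx> (-1) ^ c * star_sum l' n' (replicate c 2)"
    if "{l..n} \<union> {l'..n'} = {1..p - 1}" "{l..n} \<inter> {l'..n'} = {}" "c < h" for l n l' n' c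
  proof -
    have "(-1) ^ c * strict_sum l n (replicate c 2) \<approx> star_sum l' n' (replicate c 2)"
      using strict_fps_complement[OF that(1,2)] that(3)
      unfolding fps_cong_def strict_fps_nth star_fps_nth by blast
    then have "(-1) ^ c * ((-1) ^ c * strict_sum l n (replicate c 2)) \<approx>
        (-1) ^ c * star_sum l' n' (replicate c 2)"
      by (intro cong_p_mult[OF cong_p_refl]) auto
    then show ?thesis by (simp flip: mult.assoc power_add)
  qed
  have "strict_sum 1 (p - 1) (replicate a 2 @ 3 # replicate b 2) \<approx>
      (\<Sum>k = 1..p - 1. ((-1) ^ a * star_sum k (p - 1) (replicate a 2)) *
        inverse (of_nat k) ^ 3 * ((-1) ^ b * star_sum 1 k (replicate b 2)))"
    unfolding strict_sum_append using assms
    by (intro cong_p_sum cong_p_mult strict cong_p_refl p_integer_power p_integer_inverse) auto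
  moreover have "(\<Sum>k = 1..p - 1. ((-1) ^ a * star_sum k (p - 1) (replicate a 2)) *
        inverse (of_nat k) ^ 3 * ((-1) ^ b * star_sum 1 k (replicate b 2))) =
      (-1) ^ (a + b) * star_sum 1 (p - 1) (replicate b 2 @ 3 # replicate a 2)"
    unfolding star_sum_append sum_distrib_left by (simp only: power_add mult_ac)
  ultimately show ?thesis by (simp only:)
qed

lemma star_sum_2s_3_2s_cong:
  assumes "2 * a + 2 * b + 3 < p"
  shows "star_sum 1 (p - 1) (replicate a 2 @ 3 # replicate b 2) \<approx>
    (of_nat b - of_nat a) / ((of_nat a + 1) * (of_nat b + 1)) *
      of_nat ((2 * a + 2 * b + 2) choose (2 * a + 1)) * bernoulli (p - 2 * a - 2 * b - 3)"
proof -
  define C :: rat where "C = of_nat ((2 * a + 2 * b + 2) choose (2 * a + 1))"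
  define B where "B = bernoulli (p - 2 * a - 2 * b - 3)"
  define W where "W a b = star_sum 1 h (replicate a 2 @ 3 # replicate b 2)" for a b
  have solve: "W a b \<approx> - (inverse (of_nat (b + 1)) * (C * B))"
    if "of_nat (b + 1) * W a b \<approx> - (C * B)" "b + 1 < p" for a b
  proof -
    have "inverse (of_nat (b + 1)) * (of_nat (b + 1) * W a b) \<approx> inverse (of_nat (b + 1)) * - (C * B)"
      using that by (intro cong_p_mult[OF cong_p_refl[OF p_integer_inverse]]) auto
    moreover have "inverse (of_nat (b + 1)) * (of_nat (b + 1) * W a b) = W a b"
      by (metis Suc_eq_plus1 left_inverse mult.assoc mult_1 of_nat_neq_0)
    ultimately show ?thesis by (simp only: mult_minus_right)
  qed
  have "p - (2 * a + 2 * b + 3) = p - 2 * a - 2 * b - 3" by simp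
  then have "of_nat (b + 1) * W a b \<approx> - (C * B)"
    using half_star_sum_2s_3_2s_cong[OF assms] by (simp only: W_def C_def B_def)
  then have 1: "W a b \<approx> - (inverse (of_nat (b + 1)) * (C * B))"
    using assms by (intro solve) auto
  have "2 * b + 2 * a + 2 choose (2 * b + 1) = 2 * a + 2 * b + 2 choose (2 * a + 1)"
    by (subst binomial_symmetric) (auto simp: add.commute)
  moreover have "p - (2 * b + 2 * a + 3) = p - 2 * a - 2 * b - 3" by simp
  ultimately have "of_nat (a + 1) * W b a \<approx> - (C * B)"
    using half_star_sum_2s_3_2s_cong[of b a] assms
    by (simp only: W_def C_def B_def add.commute[of "2 * b" "2 * a"])
  then have 2: "W b a \<approx> - (inverse (of_nat (a + 1)) * (C * B))"
    using assms by (intro solve) auto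
  have "star_sum 1 (p - 1) (replicate a 2 @ 3 # replicate b 2) \<approx> W a b - W b a"
    unfolding W_def using assms p_eq by (intro star_sum_2s_3_2s_split_half) auto
  also have "\<dots> \<approx> - (inverse (of_nat (b + 1)) * (C * B)) - - (inverse (of_nat (a + 1)) * (C * B))"
    by (rule cong_p_diff[OF 1 2])
  also have "\<dots> = (of_nat b - of_nat a) / ((of_nat a + 1) * (of_nat b + 1)) * C * B"
  proof -
    define x y :: rat where "x = of_nat (a + 1)" and "y = of_nat (b + 1)"
    have "x \<noteq> 0" "y \<noteq> 0" by (simp_all only: x_def y_def of_nat_eq_0_iff)
    then have "- (inverse y * (C * B)) - - (inverse x * (C * B)) = (y - x) / (x * y) * C * B"
      by (simp add: field_simps)
    then show ?thesis by (simp add: x_def y_def add.commute)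
  qed
  finally show ?thesis by (simp only: C_def B_def)
qed

end

section \<open>The congruences for star and strict sums\<close>

theorem theorem4p1:
  fixes a b p :: nat
  assumes "prime p" and "p > 2 * a + 2 * b + 3"
  shows "rat_cong p 1
           (mhs_S (p - 1) (replicate a 2 @ [3] @ replicate b 2))
           ((of_nat b - of_nat a) / ((of_nat a + 1) * (of_nat b + 1)) *
              of_nat ((2 * a + 2 * b + 2) choose (2 * a + 1)) *
              bernoulli (p - 2 * a - 2 * b - 3)) \<and>
         rat_cong p 1
           (mhs_H (p - 1) (replicate a 2 @ [3] @ replicate b 2))
           ((-1) ^ (a + b) * (of_nat a - of_nat b) / ((of_nat a + 1) * (of_nat b + 1)) *
              of_nat ((2 * a + 2 * b + 2) choose (2 * a + 1)) *
              bernoulli (p - 2 * a - 2 * b - 3))"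
proof -
  have "odd p" using assms prime_odd_nat[of p] by simp
  then obtain h where h: "p = 2 * h + 1" by (elim oddE)
  interpret odd_prime_modulus p h
    using assms h by unfold_locales
  define C :: "nat \<Rightarrow> nat \<Rightarrow> rat" where "C a b = of_nat ((2 * a + 2 * b + 2) choose (2 * a + 1))" for a b
  have C: "C b a = C a b"
    unfolding C_def by (subst binomial_symmetric) (auto simp: add.commute)
  have B: "p - 2 * b - 2 * a - 3 = p - 2 * a - 2 * b - 3" by simp
  have "strict_sum 1 (p - 1) (replicate a 2 @ 3 # replicate b 2) \<approx>
      (-1) ^ (a + b) * star_sum 1 (p - 1) (replicate b 2 @ 3 # replicate a 2)"
    using assms h by (intro strict_sum_2s_3_2s_cong_star_sum) auto
  also have "\<dots> \<approx> (-1) ^ (a + b) * ((of_nat a - of_nat b) / ((of_nat b + 1) * (of_nat a + 1)) *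
      C b a * bernoulli (p - 2 * b - 2 * a - 3))"
    unfolding C_def using assms by (intro cong_p_mult[OF cong_p_refl] star_sum_2s_3_2s_cong) auto
  also have "\<dots> = (-1) ^ (a + b) * (of_nat a - of_nat b) / ((of_nat a + 1) * (of_nat b + 1)) *
      C a b * bernoulli (p - 2 * a - 2 * b - 3)"
    unfolding C B by (simp add: mult.commute)
  finally have H: "strict_sum 1 (p - 1) (replicate a 2 @ 3 # replicate b 2) \<approx>
      (-1) ^ (a + b) * (of_nat a - of_nat b) / ((of_nat a + 1) * (of_nat b + 1)) *
      C a b * bernoulli (p - 2 * a - 2 * b - 3)" .
  show ?thesis
    using cong_imp_rat_cong[OF star_sum_2s_3_2s_cong[OF assms(2)]]
      cong_imp_rat_cong[OF H[unfolded C_def]]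
    by (simp only: mhs_S_eq_star_sum mhs_H_eq_strict_sum append_Cons append_Nil)
qed

end
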